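(* Let $(\mathcal G,(\cdot,\cdot),\mathcal H)$ be an indecomposable generalized reductive Lie algebra with root system $R$, and let $R_t^0$, $\Lambda_t$ and $\dot R$ be as described in the context. Then the Lie algebra $\mathcal G_c/\mathcal Z(\mathcal G_c)$ (the core modulo its center) is a Lie torus of type $(\dot R,\Lambda_t)$.
   Context: Let $\mathcal G$ be a complex Lie algebra, $\mathcal H$ a subalgebra and $(\cdot,\cdot)$ a bilinear form on $\mathcal G$. Axioms: (GR1) $(\cdot,\cdot)$ is symmetric, nondegenerate and invariant. (GR2) $\mathcal H$ is a nontrivial finite-dimensional abelian subalgebra equal to its own centralizer in $\mathcal G$, and $\mathrm{ad}(h)$ is diagonalizable for all $h\in\mathcal H$. Then $\mathcal G=\bigoplus_{\alpha\in\mathcal H^*}\mathcal G_\alpha$ with $\mathcal G_\alpha=\{x:[h,x]=\alpha(h)x\ \forall h\in\mathcal H\}$; the root system is $R=\{\alpha\in\mathcal H^*:\mathcal G_\alpha\neq0\}$. The form is nondegenerate on $\mathcal H$; for $\alpha\in\mathcal H^*$ let $t_\alpha\in\mathcal H$ satisfy $(t_\alpha,h)=\alpha(h)$ for all $h$, and set $(\alpha,\beta):=(t_\alpha,t_\beta)$. Let $R^\times=\{\alpha\in R:(\alpha,\alpha)\ne0\}$, $R^0=\{\alpha\in R:(\alpha,\alpha)=0\}$. (GR3) For $\alpha\in R^\times$, $x\in\mathcal G_\alpha$, $\mathrm{ad}(x)$ is locally nilpotent on $\mathcal G$. (GR4) $R$ is discrete in $\mathcal H^*$. (GR5) $R^\times\neq\emptyset$.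 A triple satisfying GR1–GR5 is a generalized reductive Lie algebra (GRLA). It is indecomposable if $R^\times$ is not a disjoint union of two nonempty subsets orthogonal to each other with respect to $(\cdot,\cdot)$. The core $\mathcal G_c$ is the subalgebra generated by the $\mathcal G_\alpha$, $\alpha\in R^\times$; $\mathcal Z(\mathcal G_c)$ is its center. For a subset $S$ of a vector space, $\langle S\rangle$ denotes its $\mathbb Z$-span. Let $R_t^0=\{\delta\in R^0:\delta+\alpha\in R\text{ for some }\alpha\in R^\times\}$, $R_t=R^\times\cup R_t^0$, $\Lambda_t=\langle R_t^0\rangle$ and $\Lambda=\langle R^0\rangle$. It is known that $\Lambda_t$ is a free abelian group of finite rank and that there is an irreducible finite (possibly non-reduced) root system $\dot R\subseteq\mathcal H^*$ (a root system in its real span with respect to a nonzero scalar multiple of $(\cdot,\cdot)$) such that $R_t\subseteq\dot R+\Lambda_t$, $\dot R_{\mathrm{ind}}\subseteq R^\times\cup\{0\}$ where $\dot R_{\mathrm{ind}}=\{\dot\alpha\in\dot R:\tfrac12\dot\alpha\notin\dot R\}$, and $\langle R\rangle=\langle\dot R\rangle\oplus\Lambda$. Lie torus: for an irreducible finite root system $\dot R$ and a free abelian group $\Lambda$ of finite rank, a complex Lie algebra $\mathcal L$ is a Lie torus of type $(\dot R,\Lambda)$ if: (LT1) $\mathcal L=\bigoplus_{\dot\alpha\in\langle\dot R\rangle,\lambda\in\Lambda}\mathcal L^\lambda_{\dot\alpha}$ with $[\mathcal L^\lambda_{\dot\alpha},\mathcal L^\mu_{\dot\beta}]\subseteq\mathcal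 L^{\lambda+\mu}_{\dot\alpha+\dot\beta}$ and $\mathcal L^\lambda_{\dot\alpha}=0$ if $\dot\alpha\notin\dot R$; (LT2) for $\dot\alpha\in\dot R\setminus\{0\}$, $\lambda\in\Lambda$: (i) $\dim\mathcal L^\lambda_{\dot\alpha}\le1$, with $\dim\mathcal L^0_{\dot\alpha}=1$ if $\dot\alpha\in\dot R_{\mathrm{ind}}$; (ii) if $\dim\mathcal L^\lambda_{\dot\alpha}=1$ there are $e\in\mathcal L^\lambda_{\dot\alpha}$, $f\in\mathcal L^{-\lambda}_{-\dot\alpha}$ such that $h=[e,f]\in\mathcal L^0_0$ acts on every $x\in\mathcal L^\mu_{\dot\beta}$ ($\dot\beta\in\dot R,\mu\in\Lambda$) by $[h,x]=(\dot\beta,\dot\alpha^\vee)x$, the Cartan integer $2(\dot\beta,\dot\alpha)/(\dot\alpha,\dot\alpha)$; (LT3) for $\lambda\in\Lambda$, $\mathcal L^\lambda_0=\sum_{\dot\alpha\in\dot R\setminus\{0\},\mu\in\Lambda}[\mathcal L^\mu_{\dot\alpha},\mathcal L^{\lambda-\mu}_{-\dot\alpha}]$; (LT4) $\Lambda$ is generated by $\{\lambda\in\Lambda:\mathcal L^\lambda_{\dot\alpha}\ne0\text{ for some }\dot\alpha\in\dot R\}$. *)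

theory Defs
  imports Main "HOL-Analysis.Analysis"
begin

text \<open>Complex Lie algebras are modelled on a type 'g :: ab_group_add together with an
explicit complex scalar multiplication sg (a library vector_space over complex) and a
bracket br; the algebra is the whole type. Linear functionals on the subalgebra H
(elements of the dual of H) are modelled as functions 'g => complex that are linear on H
and vanish outside H.\<close>

type_synonym 'g functional = "'g \<Rightarrow> complex"

definition fzero :: "'g functional" where "fzero = (\<lambda>_. 0)"
definition fplus :: "'g functional \<Rightarrow> 'g functional \<Rightarrow> 'g functional"
  where "fplus a b = (\<lambda>h. a h + b h)"
definition fneg :: "'g functional \<Rightarrow> 'g functional" where "fneg a = (\<lambda>h. - a h)"
definition fminus :: "'g functional \<Rightarrow> 'g functional \<Rightarrow> 'g functional"
  where "fminus a b = (\<lambda>h. a h - b h)"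

definition zspan :: "'g functional set \<Rightarrow> 'g functional set" where
  "zspan S = {f. \<exists>F n. finite F \<and> F \<subseteq> S \<and> f = (\<lambda>h. \<Sum>a\<in>F. of_int (n a) * a h)}"
definition rspan :: "'g functional set \<Rightarrow> 'g functional set" where
  "rspan S = {f. \<exists>F r. finite F \<and> F \<subseteq> S \<and> f = (\<lambda>h. \<Sum>a\<in>F. of_real (r a) * a h)}"

definition free_abelian_finite_rank :: "'g functional set \<Rightarrow> bool" where
  "free_abelian_finite_rank L \<longleftrightarrow> (\<exists>S. finite S \<and> zspan S = L \<and>
     (\<forall>n :: 'g functional \<Rightarrow> int. (\<lambda>h. \<Sum>a\<in>S. of_int (n a) * a h) = fzero \<longrightarrow> (\<forall>a\<in>S. n a = 0)))"

definition lie_algebra :: "(complex \<Rightarrow> 'g::ab_group_add \<Rightarrow> 'g) \<Rightarrow> ('g \<Rightarrow> 'g \<Rightarrow> 'g) \<Rightarrow> bool" where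
  "lie_algebra sg br \<longleftrightarrow> vector_space sg \<and>
     (\<forall>c x y z. br (sg c x + y) z = sg c (br x z) + br y z) \<and>
     (\<forall>x. br x x = 0) \<and>
     (\<forall>x y z. br x (br y z) + br y (br z x) + br z (br x y) = 0)"

definition dual :: "(complex \<Rightarrow> 'g::ab_group_add \<Rightarrow> 'g) \<Rightarrow> 'g set \<Rightarrow> 'g functional set" where
  "dual sg H = {a. (\<forall>c h k. h \<in> H \<longrightarrow> k \<in> H \<longrightarrow> a (sg c h + k) = c * a h + a k) \<and>
                   (\<forall>x. x \<notin> H \<longrightarrow> a x = 0)}"

definition root_space :: "('g \<Rightarrow> 'g \<Rightarrow> 'g) \<Rightarrow> (complex \<Rightarrow> 'g \<Rightarrow> 'g) \<Rightarrow> 'g set \<Rightarrow> 'g functional \<Rightarrow> 'g set" where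
  "root_space br sg H a = {x. \<forall>h\<in>H. br h x = sg (a h) x}"

definition roots :: "('g \<Rightarrow> 'g \<Rightarrow> 'g) \<Rightarrow> (complex \<Rightarrow> 'g::ab_group_add \<Rightarrow> 'g) \<Rightarrow> 'g set \<Rightarrow> 'g functional set" where
  "roots br sg H = {a \<in> dual sg H. root_space br sg H a \<noteq> {0}}"

definition tvec :: "('g \<Rightarrow> 'g \<Rightarrow> complex) \<Rightarrow> 'g set \<Rightarrow> 'g functional \<Rightarrow> 'g" where
  "tvec B H a = (THE t. t \<in> H \<and> (\<forall>h\<in>H. B t h = a h))"

definition fform :: "('g \<Rightarrow> 'g \<Rightarrow> complex) \<Rightarrow> 'g set \<Rightarrow> 'g functional \<Rightarrow> 'g functional \<Rightarrow> complex" where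
  "fform B H a b = B (tvec B H a) (tvec B H b)"

definition nonisotropic_roots where
  "nonisotropic_roots br sg B H = {a \<in> roots br sg H. fform B H a a \<noteq> 0}"
definition isotropic_roots where
  "isotropic_roots br sg B H = {a \<in> roots br sg H. fform B H a a = 0}"

definition grla :: "(complex \<Rightarrow> 'g::ab_group_add \<Rightarrow> 'g) \<Rightarrow> ('g \<Rightarrow> 'g \<Rightarrow> 'g) \<Rightarrow> ('g \<Rightarrow> 'g \<Rightarrow> complex) \<Rightarrow> 'g set \<Rightarrow> bool" where
  "grla sg br B H \<longleftrightarrow> lie_algebra sg br \<and>
     \<comment> \<open>GR1\<close>
     (\<forall>x y. B x y = B y x) \<and>
     (\<forall>c x y z. B (sg c x + y) z = c * B x z + B y z) \<and>
     (\<forall>x. (\<forall>y. B x y = 0) \<longrightarrow> x = 0) \<and>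
     (\<forall>x y z. B (br x y) z = B x (br y z)) \<and>
     \<comment> \<open>GR2\<close>
     module.subspace sg H \<and> H \<noteq> {0} \<and> (\<exists>S. finite S \<and> H = module.span sg S) \<and>
     (\<forall>h\<in>H. \<forall>k\<in>H. br h k = 0) \<and>
     {x. \<forall>h\<in>H. br h x = 0} = H \<and>
     (\<forall>h\<in>H. module.span sg {x. \<exists>c. br h x = sg c x} = UNIV) \<and>
     \<comment> \<open>GR3\<close>
     (\<forall>a\<in>nonisotropic_roots br sg B H. \<forall>x\<in>root_space br sg H a. \<forall>y. \<exists>n. (br x ^^ n) y = 0) \<and>
     \<comment> \<open>GR4: discreteness of R in H^* (natural topology = pointwise topology, H finite-dim.)\<close>
     (\<forall>a\<in>roots br sg H. \<exists>F e. finite F \<and> F \<subseteq> H \<and> e > (0::real) \<and>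
        (\<forall>b\<in>roots br sg H. (\<forall>h\<in>F. cmod (b h - a h) < e) \<longrightarrow> b = a)) \<and>
     \<comment> \<open>GR5\<close>
     nonisotropic_roots br sg B H \<noteq> {}"

definition indecomposable where
  "indecomposable br sg B H \<longleftrightarrow> \<not> (\<exists>P Q. P \<noteq> {} \<and> Q \<noteq> {} \<and> P \<inter> Q = {} \<and>
      P \<union> Q = nonisotropic_roots br sg B H \<and> (\<forall>a\<in>P. \<forall>b\<in>Q. fform B H a b = 0))"

inductive_set gen_subalg :: "(complex \<Rightarrow> 'g::ab_group_add \<Rightarrow> 'g) \<Rightarrow> ('g \<Rightarrow> 'g \<Rightarrow> 'g) \<Rightarrow> 'g set \<Rightarrow> 'g set"
  for sg br S where
  base: "x \<in> S \<Longrightarrow> x \<in> gen_subalg sg br S"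
| zero: "0 \<in> gen_subalg sg br S"
| add: "x \<in> gen_subalg sg br S \<Longrightarrow> y \<in> gen_subalg sg br S \<Longrightarrow> x + y \<in> gen_subalg sg br S"
| scale: "x \<in> gen_subalg sg br S \<Longrightarrow> sg c x \<in> gen_subalg sg br S"
| brk: "x \<in> gen_subalg sg br S \<Longrightarrow> y \<in> gen_subalg sg br S \<Longrightarrow> br x y \<in> gen_subalg sg br S"

definition core where
  "core sg br B H = gen_subalg sg br (\<Union>a\<in>nonisotropic_roots br sg B H. root_space br sg H a)"

definition center_of :: "('g \<Rightarrow> 'g \<Rightarrow> 'g::ab_group_add) \<Rightarrow> 'g set \<Rightarrow> 'g set" where
  "center_of br A = {z \<in> A. \<forall>y\<in>A. br z y = 0}"

definition Rt0 where
  "Rt0 br sg B H = {d \<in> isotropic_roots br sg B H.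
      \<exists>a\<in>nonisotropic_roots br sg B H. fplus d a \<in> roots br sg H}"
definition Rt where
  "Rt br sg B H = nonisotropic_roots br sg B H \<union> Rt0 br sg B H"
definition Lambda_t where "Lambda_t br sg B H = zspan (Rt0 br sg B H)"
definition Lambda where "Lambda br sg B H = zspan (isotropic_roots br sg B H)"

text \<open>Finite root systems (containing 0, possibly non-reduced), w.r.t. a complex form
on functionals, living in their real span where a nonzero multiple of the form is
an inner product.\<close>
definition cartan :: "('g functional \<Rightarrow> 'g functional \<Rightarrow> complex) \<Rightarrow> 'g functional \<Rightarrow> 'g functional \<Rightarrow> complex" where
  "cartan f b a = 2 * f b a / f a a"

definition reflect where
  "reflect f a b = (\<lambda>h. b h - cartan f b a * a h)"

definition irreducible_finite_root_system ::
  "('g functional \<Rightarrow> 'g functional \<Rightarrow> complex) \<Rightarrow> 'g functional set \<Rightarrow> bool" where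
  "irreducible_finite_root_system f Rd \<longleftrightarrow>
     finite Rd \<and> fzero \<in> Rd \<and> Rd \<noteq> {fzero} \<and>
     (\<exists>c. c \<noteq> 0 \<and> (\<forall>v\<in>rspan Rd. c * f v v \<in> \<real> \<and> (v \<noteq> fzero \<longrightarrow> Re (c * f v v) > 0))) \<and>
     (\<forall>a\<in>Rd - {fzero}. \<forall>b\<in>Rd. cartan f b a \<in> \<int> \<and> reflect f a b \<in> Rd) \<and>
     \<not> (\<exists>P Q. P \<noteq> {} \<and> Q \<noteq> {} \<and> P \<inter> Q = {} \<and> P \<union> Q = Rd - {fzero} \<and>
          (\<forall>a\<in>P. \<forall>b\<in>Q. f a b = 0))"

definition indivisible where
  "indivisible Rd = {a \<in> Rd. (\<lambda>h. a h / 2) \<notin> Rd}"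

definition lie_torus ::
  "(complex \<Rightarrow> 'l::ab_group_add \<Rightarrow> 'l) \<Rightarrow> ('l \<Rightarrow> 'l \<Rightarrow> 'l) \<Rightarrow>
   ('g functional \<Rightarrow> 'g functional \<Rightarrow> complex) \<Rightarrow> 'g functional set \<Rightarrow> 'g functional set \<Rightarrow> bool" where
  "lie_torus sl brL f Rd Lam \<longleftrightarrow>
    lie_algebra sl brL \<and> irreducible_finite_root_system f Rd \<and> free_abelian_finite_rank Lam \<and>
    (\<exists>Lg :: 'g functional \<Rightarrow> 'g functional \<Rightarrow> 'l set.
      \<comment> \<open>LT1\<close>
      (\<forall>a\<in>zspan Rd. \<forall>l\<in>Lam. module.subspace sl (Lg a l)) \<and>
      (\<forall>x. \<exists>F v. finite F \<and> F \<subseteq> zspan Rd \<times> Lam \<and> (\<forall>(a,l)\<in>F. v (a,l) \<in> Lg a l) \<and>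
           x = (\<Sum>p\<in>F. v p)) \<and>
      (\<forall>F v. finite F \<and> F \<subseteq> zspan Rd \<times> Lam \<and> (\<forall>(a,l)\<in>F. v (a,l) \<in> Lg a l) \<and>
           (\<Sum>p\<in>F. v p) = 0 \<longrightarrow> (\<forall>p\<in>F. v p = 0)) \<and>
      (\<forall>a\<in>zspan Rd. \<forall>b\<in>zspan Rd. \<forall>l\<in>Lam. \<forall>m\<in>Lam. \<forall>x\<in>Lg a l. \<forall>y\<in>Lg b m.
           brL x y \<in> Lg (fplus a b) (fplus l m)) \<and>
      (\<forall>a\<in>zspan Rd - Rd. \<forall>l\<in>Lam. Lg a l = {0}) \<and>
      \<comment> \<open>LT2 (i)\<close>
      (\<forall>a\<in>Rd - {fzero}. \<forall>l\<in>Lam. \<exists>v. Lg a l \<subseteq> module.span sl {v}) \<and>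
      (\<forall>a\<in>indivisible Rd. Lg a fzero \<noteq> {0}) \<and>
      \<comment> \<open>LT2 (ii)\<close>
      (\<forall>a\<in>Rd - {fzero}. \<forall>l\<in>Lam. Lg a l \<noteq> {0} \<longrightarrow>
         (\<exists>e\<in>Lg a l. \<exists>g\<in>Lg (fneg a) (fneg l). brL e g \<in> Lg fzero fzero \<and>
            (\<forall>b\<in>Rd. \<forall>m\<in>Lam. \<forall>x\<in>Lg b m. brL (brL e g) x = sl (cartan f b a) x))) \<and>
      \<comment> \<open>LT3\<close>
      (\<forall>l\<in>Lam. Lg fzero l = module.span sl
         {brL x y | x y a m. a \<in> Rd - {fzero} \<and> m \<in> Lam \<and> x \<in> Lg a m \<and> y \<in> Lg (fneg a) (fminus l m)}) \<and>
      \<comment> \<open>LT4\<close>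
      Lam = zspan {l \<in> Lam. \<exists>a\<in>Rd. Lg a l \<noteq> {0}})"

definition is_quotient_map ::
  "(complex \<Rightarrow> 'g::ab_group_add \<Rightarrow> 'g) \<Rightarrow> ('g \<Rightarrow> 'g \<Rightarrow> 'g) \<Rightarrow>
   (complex \<Rightarrow> 'l::ab_group_add \<Rightarrow> 'l) \<Rightarrow> ('l \<Rightarrow> 'l \<Rightarrow> 'l) \<Rightarrow> ('g \<Rightarrow> 'l) \<Rightarrow> 'g set \<Rightarrow> 'g set \<Rightarrow> bool" where
  "is_quotient_map sg br sl brL p A Z \<longleftrightarrow>
     (\<forall>c. \<forall>x\<in>A. \<forall>y\<in>A. p (sg c x + y) = sl c (p x) + p y) \<and>
     (\<forall>x\<in>A. \<forall>y\<in>A. p (br x y) = brL (p x) (p y)) \<and>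
     p ` A = UNIV \<and>
     {x \<in> A. p x = 0} = Z"

end

theory Submission
  imports Defs "HOL-Library.Function_Algebras"
begin

text \<open>Commuting diagonalizable operators give the root space decomposition, and
  \<open>[x, y] = (x, y) t\<^sub>a\<close> for \<open>x\<close>, \<open>y\<close> in opposite root spaces turns every nonisotropic root into
  an \<open>sl\<^sub>2\<close>-triple with locally nilpotent \<open>e\<close> and \<open>f\<close>. Hence Cartan numbers are integers,
  reflections preserve \<open>R\<close>, and nonisotropic root spaces are lines. A Heisenberg triple shows
  that isotropic roots are orthogonal to the nonisotropic ones, so \<open>(a + l, b + m) = (a, b)\<close> for
  \<open>a\<close>, \<open>b\<close> in the finite root system and \<open>l\<close>, \<open>m\<close> in \<open>\<Lambda>\<^sub>t\<close>. If \<open>K\<close> denotes the sum of the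
  nonisotropic root spaces, it follows that the core is \<open>K + [K, K]\<close> and that its degrees lie in
  \<open>R\<^sub>t\<close>. Modulo its (graded) center it is graded by the pairs \<open>(a, l)\<close> through \<open>a + l\<close>, and
  the Lie torus axioms can be read off. Freeness of \<open>\<Lambda>\<^sub>t\<close> comes from the discreteness of \<open>R\<close>.\<close>

section \<open>Integral spans and discrete groups of functionals\<close>

text \<open>Two facts keep the core small. If \<open>a\<close> and \<open>b\<close> are nonisotropic
  and \<open>d = a + b\<close> is an isotropic root, then \<open>d + (- a) = b\<close> puts
  \<open>d\<close> into \<open>R_t^0\<close>. And adding an isotropic root to a nonisotropic one
  preserves the square length, so such a sum is never isotropic. Two obstacles shape the rest. Only
  the indivisible elements of the finite root system are known to be roots, so a divisible element
  has to be handled through its half. And discreteness is given for \<open>R\<close>, which is not a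
  group, whereas freeness of \<open>\<Lambda>_t\<close> calls for a discrete group. Torsion is
  impossible among complex functionals, so what the reflections have to supply is finite
  generation.\<close>

lemma functional_ops:
  "fzero = 0" "fplus a b = a + b" "fneg a = - a" "fminus a b = a - b"
  by (auto simp: fzero_def fplus_def fneg_def fminus_def)

definition additive_subgroup :: "'a::ab_group_add set \<Rightarrow> bool" where
  "additive_subgroup L \<longleftrightarrow> 0 \<in> L \<and> (\<forall>x\<in>L. \<forall>y\<in>L. x + y \<in> L) \<and> (\<forall>x\<in>L. - x \<in> L)"

lemma additive_subgroupD:
  assumes "additive_subgroup L"
  shows "0 \<in> L" "x \<in> L \<Longrightarrow> y \<in> L \<Longrightarrow> x + y \<in> L" "x \<in> L \<Longrightarrow> - x \<in> L"
    "x \<in> L \<Longrightarrow> y \<in> L \<Longrightarrow> x - y \<in> L"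
  using assms unfolding additive_subgroup_def by (auto simp: diff_conv_add_uminus simp del: add_uminus_conv_diff)

lemma sum_fun_apply: "(\<Sum>a\<in>A. f a) x = (\<Sum>a\<in>A. f a x)"
  by (induct A rule: infinite_finite_induct) auto

lemma additive_subgroup_sum:
  assumes "additive_subgroup L" "\<And>a. a \<in> F \<Longrightarrow> g a \<in> L"
  shows "(\<Sum>a\<in>F. g a) \<in> L"
  using assms(2) by (induct F rule: infinite_finite_induct) (auto simp: additive_subgroupD[OF assms(1)])

lemma additive_subgroup_of_int_mult:
  fixes L :: "('a \<Rightarrow> complex) set"
  assumes "additive_subgroup L" "a \<in> L"
  shows "(\<lambda>h. of_int n * a h) \<in> L"
proof -
  have nat: "(\<lambda>h. of_nat k * a h) \<in> L" for k
  proof (induct k)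
    case 0
    then show ?case using additive_subgroupD(1)[OF assms(1)] by (simp add: zero_fun_def)
  next
    case (Suc k)
    have "(\<lambda>h. of_nat (Suc k) * a h) = a + (\<lambda>h. of_nat k * a h)"
      by (auto simp: algebra_simps)
    then show ?case using Suc additive_subgroupD(2)[OF assms] by simp
  qed
  show ?thesis
  proof (cases "n \<ge> 0")
    case True
    then show ?thesis using nat[of "nat n"] by simp
  next
    case False
    then have "(\<lambda>h. of_int n * a h) = - (\<lambda>h. of_nat (nat (- n)) * a h)"
      by auto
    then show ?thesis using nat additive_subgroupD(3)[OF assms(1)] by metis
  qed
qed

text \<open>Plays the part of induction over an integral span: a property that cuts out a subgroup,
  such as orthogonality, passes from \<open>S\<close> to \<open>zspan S\<close>.\<close>

lemma zspan_least:
  assumes "additive_subgroup L" "S \<subseteq> L"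
  shows "zspan S \<subseteq> L"
proof
  fix f assume "f \<in> zspan S"
  then obtain F n where F: "finite F" "F \<subseteq> S" "f = (\<lambda>h. \<Sum>a\<in>F. of_int (n a) * a h)"
    unfolding zspan_def by blast
  have "f = (\<Sum>a\<in>F. (\<lambda>h. of_int (n a) * a h))"
    by (auto simp: F sum_fun_apply)
  moreover have "\<dots> \<in> L"
    using F assms by (intro additive_subgroup_sum additive_subgroup_of_int_mult) auto
  ultimately show "f \<in> L" by simp
qed

lemma zspanI: "finite F \<Longrightarrow> F \<subseteq> S \<Longrightarrow> (\<lambda>h. \<Sum>a\<in>F. of_int (n a) * a h) \<in> zspan S"
  unfolding zspan_def by blast

lemma additive_subgroup_zspan [simp]: "additive_subgroup (zspan S)"
proof -
  have "0 \<in> zspan S" using zspanI[of "{}" S] by (simp add: zero_fun_def)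
  moreover have "x + y \<in> zspan S" if xy: "x \<in> zspan S" "y \<in> zspan S" for x y
  proof -
    obtain F n where F: "finite F" "F \<subseteq> S" "x = (\<lambda>h. \<Sum>a\<in>F. of_int (n a) * a h)"
      using xy unfolding zspan_def by blast
    obtain F' n' where F': "finite F'" "F' \<subseteq> S" "y = (\<lambda>h. \<Sum>a\<in>F'. of_int (n' a) * a h)"
      using xy unfolding zspan_def by blast
    define N where "N a = (if a \<in> F then n a else 0) + (if a \<in> F' then n' a else 0)" for a
    have "(\<Sum>a\<in>F \<union> F'. of_int (N a) * a h) = x h + y h" for h
    proof -
      have "x h = (\<Sum>a\<in>F \<union> F'. of_int (if a \<in> F then n a else 0) * a h)"
        unfolding F(3) using F(1) F'(1) by (intro sum.mono_neutral_cong_left) auto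
      moreover have "y h = (\<Sum>a\<in>F \<union> F'. of_int (if a \<in> F' then n' a else 0) * a h)"
        unfolding F'(3) using F(1) F'(1) by (intro sum.mono_neutral_cong_left) auto
      ultimately show ?thesis
        by (simp add: N_def distrib_right sum.distrib)
    qed
    then have "x + y = (\<lambda>h. \<Sum>a\<in>F \<union> F'. of_int (N a) * a h)" by auto
    then show ?thesis using zspanI[of "F \<union> F'" S N] F F' by simp
  qed
  moreover have "- x \<in> zspan S" if x: "x \<in> zspan S" for x
  proof -
    obtain F n where F: "finite F" "F \<subseteq> S" "x = (\<lambda>h. \<Sum>a\<in>F. of_int (n a) * a h)"
      using x unfolding zspan_def by blast
    have "- x = (\<lambda>h. \<Sum>a\<in>F. of_int (- n a) * a h)"
      by (auto simp: F(3) sum_negf)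
    then show ?thesis using zspanI[of F S "\<lambda>a. - n a"] F by simp
  qed
  ultimately show ?thesis unfolding additive_subgroup_def by blast
qed

lemma zspan_base: "a \<in> S \<Longrightarrow> a \<in> zspan S"
  using zspanI[of "{a}" S "\<lambda>_. 1"] by simp

lemmas zspan_zero = additive_subgroupD(1)[OF additive_subgroup_zspan]
lemmas zspan_add = additive_subgroupD(2)[OF additive_subgroup_zspan]
lemmas zspan_neg = additive_subgroupD(3)[OF additive_subgroup_zspan]
lemmas zspan_diff = additive_subgroupD(4)[OF additive_subgroup_zspan]

lemma zspan_subset_iff: "zspan S \<subseteq> zspan T \<longleftrightarrow> S \<subseteq> zspan T"
  using zspan_base zspan_least[OF additive_subgroup_zspan, of S T] by blast

lemma zspan_UN_finitely_generated:
  assumes "finite I" "\<And>i. i \<in> I \<Longrightarrow> \<exists>T. finite T \<and> zspan T = zspan (S i)"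
  shows "\<exists>T. finite T \<and> zspan T = zspan (\<Union>i\<in>I. S i)"
proof -
  obtain T where T: "\<And>i. i \<in> I \<Longrightarrow> finite (T i) \<and> zspan (T i) = zspan (S i)"
    using assms(2) by metis
  have "zspan (\<Union>i\<in>I. T i) = zspan (\<Union>i\<in>I. S i)"
  proof (rule equalityI; unfold zspan_subset_iff; rule UN_least)
    fix i assume i: "i \<in> I"
    have "T i \<subseteq> zspan (S i)" "S i \<subseteq> zspan (T i)" using T[OF i] zspan_base by blast+
    moreover have "zspan (S i) \<subseteq> zspan (\<Union>i\<in>I. S i)" "zspan (T i) \<subseteq> zspan (\<Union>i\<in>I. T i)"
      using i zspan_base unfolding zspan_subset_iff by blast+
    ultimately show "T i \<subseteq> zspan (\<Union>i\<in>I. S i)" "S i \<subseteq> zspan (\<Union>i\<in>I. T i)" by blast+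
  qed
  then show ?thesis using T assms(1) by (intro exI[of _ "\<Union>i\<in>I. T i"]) auto
qed

text \<open>Among the generating sets of least cardinality, take one that carries a nontrivial
  relation of least total weight. Two nonzero coefficients would allow a Euclidean step which
  lowers the weight, so the relation reads \<open>n a = 0\<close>, and \<open>a\<close> can be dropped.\<close>
lemma finitely_generated_imp_free_abelian:
  fixes L :: "'a functional set"
  assumes "finite T" "zspan T = L"
  shows "free_abelian_finite_rank L"
proof (rule ccontr)
  assume not_free: "\<not> ?thesis"
  define gen where "gen S \<longleftrightarrow> finite S \<and> zspan S = L" for S :: "'a functional set"
  define k where "k = (LEAST k. \<exists>S. gen S \<and> card S = k)"
  have k_le: "k \<le> card S" if "gen S" for S
    unfolding k_def using that by (intro Least_le) blast
  have "\<exists>S. gen S \<and> card S = k"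
    unfolding k_def by (rule LeastI[of _ "card T"]) (use assms in \<open>auto simp: gen_def\<close>)
  then obtain S0 where S0: "gen S0" "card S0 = k" by blast
  define rel where "rel S n \<longleftrightarrow> gen S \<and> card S = k \<and>
      (\<lambda>h. \<Sum>a\<in>S. of_int (n a) * a h) = fzero \<and> (\<exists>a\<in>S. n a \<noteq> 0)"
    for S :: "'a functional set" and n :: "'a functional \<Rightarrow> int"
  define w where "w Sn = (\<Sum>a\<in>fst Sn. nat \<bar>snd Sn a\<bar>)"
    for Sn :: "'a functional set \<times> ('a functional \<Rightarrow> int)"
  obtain n0 where n0: "rel S0 n0"
    using not_free S0 unfolding free_abelian_finite_rank_def rel_def gen_def by blast
  define Sn where "Sn = arg_min w (\<lambda>(S, n). rel S n)"
  have "(\<lambda>(S, n). rel S n) Sn"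
    unfolding Sn_def by (rule arg_min_natI[of _ "(S0, n0)"]) (simp add: n0)
  moreover have minw: "w Sn \<le> w (S, n)" if "rel S n" for S n
    unfolding Sn_def by (rule arg_min_nat_le) (simp add: that)
  moreover obtain S n where Sn': "Sn = (S, n)" by force
  ultimately have rel: "rel S n" by simp
  have fin: "finite S" and zS: "zspan S = L" and cS: "card S = k"
    using rel unfolding rel_def gen_def by auto
  have relh: "(\<Sum>a\<in>S. of_int (n a) * a h) = 0" for h
    using rel unfolding rel_def by (metis fzero_def)
  obtain a where a: "a \<in> S" "n a \<noteq> 0" using rel unfolding rel_def by blast
  show False
  proof (cases "\<exists>b\<in>S. b \<noteq> a \<and> n b \<noteq> 0")
    case False
    have "(\<Sum>b\<in>S. of_int (n b) * b h) = of_int (n a) * a h" for h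
      using False fin a by (subst sum.remove[of _ a]) (auto intro!: sum.neutral)
    then have "a = 0" using relh a by (auto simp: fun_eq_iff)
    have "S \<subseteq> zspan (S - {a})"
    proof
      fix b assume "b \<in> S"
      then show "b \<in> zspan (S - {a})"
        using zspan_zero[of "S - {a}"] zspan_base[of b "S - {a}"] \<open>a = 0\<close> by (cases "b = a") auto
    qed
    moreover have "S - {a} \<subseteq> zspan S" using zspan_base by blast
    ultimately have "zspan (S - {a}) = L"
      unfolding zS[symmetric] by (simp add: set_eq_subset zspan_subset_iff)
    then have "k \<le> card (S - {a})" using fin by (intro k_le) (auto simp: gen_def)
    then show False using a fin cS by (metis card_Diff1_less leD)
  next
    case True
    then obtain b where b: "b \<in> S" "b \<noteq> a" "n b \<noteq> 0" by blast
    obtain x y where xy: "x \<in> S" "y \<in> S" "x \<noteq> y" "n x \<noteq> 0" "n y \<noteq> 0" "\<bar>n y\<bar> \<le> \<bar>n x\<bar>"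
      using a b by (metis linear)
    \<comment> \<open>The sign gives \<open>n x - s * n y\<close> the absolute value
      \<open>|n x| - |n y|\<close>. Replacing \<open>y\<close> by \<open>y' = y + s * x\<close>
      keeps the span, and \<open>n y * y' + (n x - s * n y) * x = n y * y + n x * x\<close> keeps
      the relation.\<close>
    define s :: int where "s = sgn (n x) * sgn (n y)"
    have s: "s = 1 \<or> s = -1" "\<bar>n x - s * n y\<bar> < \<bar>n x\<bar>"
      using xy unfolding s_def by (auto simp: sgn_if)
    define y' where "y' = (if s = 1 then y + x else y - x)"
    define U where "U = S - {y}"
    have U: "finite U" "y \<notin> U" "S = insert y U" "x \<in> U" using xy fin by (auto simp: U_def)
    define S' where "S' = insert y' U"
    have "y \<in> zspan S'"
    proof -
      have "y = (if s = 1 then y' - x else y' + x)" using s by (auto simp: y'_def)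
      then show ?thesis using zspan_diff zspan_add zspan_base[of x S'] zspan_base[of y' S'] U
        by (metis S'_def insertI1 insertI2)
    qed
    moreover have "y' \<in> zspan S"
      using zspan_diff zspan_add zspan_base[of x S] zspan_base[of y S] xy by (auto simp: y'_def)
    moreover have "U \<subseteq> zspan S" "U \<subseteq> zspan S'"
      using zspan_base[of _ S] zspan_base[of _ S'] by (auto simp: S'_def U_def simp del: insert_Diff_single)
    ultimately have "S \<subseteq> zspan S'" "S' \<subseteq> zspan S" using U(3) S'_def by auto
    then have zS': "zspan S' = L"
      unfolding zS[symmetric] by (simp add: set_eq_subset zspan_subset_iff)
    have genS': "gen S'" using zS' U by (simp add: gen_def S'_def)
    \<comment> \<open>Were \<open>y'\<close> already present, \<open>S'\<close> would generate
      \<open>L\<close> with fewer than \<open>k\<close> elements.\<close>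
    have y': "y' \<notin> U"
    proof
      assume "y' \<in> U"
      then have "card S' < card S" using U by (simp add: S'_def insert_absorb)
      then show False using k_le[OF genS'] cS by simp
    qed
    define n' where "n' z = (if z = y' then n y else if z = x then n x - s * n y else n z)" for z
    have xy': "x \<noteq> y'" using y' U by blast
    define W where "W = U - {x}"
    have W: "U = insert x W" "x \<notin> W" "finite W" "y \<notin> W" "y' \<notin> W" using U y' by (auto simp: W_def)
    have nW: "n' z = n z" if "z \<in> W" for z using that W by (auto simp: n'_def)
    have "(\<Sum>z\<in>S'. of_int (n' z) * z h) = (\<Sum>z\<in>S. of_int (n z) * z h)" for h
    proof -
      have "(\<Sum>z\<in>S'. of_int (n' z) * z h) = of_int (n y) * y' h + of_int (n x - s * n y) * x h
          + (\<Sum>z\<in>W. of_int (n z) * z h)"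
        using W y' xy' nW by (simp add: S'_def n'_def cong: sum.cong_simp)
      moreover have "(\<Sum>z\<in>S. of_int (n z) * z h) = of_int (n y) * y h + of_int (n x) * x h
          + (\<Sum>z\<in>W. of_int (n z) * z h)"
        using W U by simp
      ultimately show ?thesis using s by (auto simp: y'_def algebra_simps)
    qed
    then have "(\<lambda>h. \<Sum>z\<in>S'. of_int (n' z) * z h) = fzero" using relh by (simp add: fzero_def)
    moreover have "card S' = k" using U y' cS by (simp add: S'_def)
    moreover have "n' y' \<noteq> 0" using xy by (simp add: n'_def)
    ultimately have "rel S' n'" using genS' unfolding rel_def S'_def by blast
    then have "w (S, n) \<le> w (S', n')" using minw Sn' by simp
    moreover have "w (S', n') = nat \<bar>n y\<bar> + nat \<bar>n x - s * n y\<bar> + (\<Sum>z\<in>W. nat \<bar>n z\<bar>)"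
      using W y' xy' nW by (simp add: w_def S'_def n'_def cong: sum.cong_simp)
    moreover have "w (S, n) = nat \<bar>n y\<bar> + nat \<bar>n x\<bar> + (\<Sum>z\<in>W. nat \<bar>n z\<bar>)"
      using W U by (simp add: w_def)
    ultimately show False using s(2) by linarith
  qed
qed

section \<open>Discrete subgroups in a real vector space of functionals\<close>

definition rscale :: "real \<Rightarrow> ('a \<Rightarrow> complex) \<Rightarrow> 'a \<Rightarrow> complex" where
  "rscale r f = (\<lambda>x. of_real r * f x)"

text \<open>Lattices are a real notion: a discrete subgroup of a complex line may have rank 2. Hence
  functionals with complex values are regarded as vectors over the reals.\<close>

interpretation real_functions: vector_space rscale
  by unfold_locales (auto simp: rscale_def algebra_simps)

text \<open>Choose a real basis inside \<open>L\<close>. Modulo its integral span every element of \<open>L\<close> lies in the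
  fundamental box, which meets the discrete group \<open>L\<close> in a finite set.\<close>
lemma discrete_subgroup_finitely_generated:
  fixes L :: "'a functional set"
  assumes L: "additive_subgroup L"
    and D: "finite D" "L \<subseteq> real_functions.span D"
    and F: "finite F" "e > (0::real)"
    and iso: "\<And>l. l \<in> L \<Longrightarrow> (\<forall>h\<in>F. cmod (l h) < e) \<Longrightarrow> l = 0"
  shows "\<exists>T. finite T \<and> zspan T = L"
proof -
  obtain Bs where Bs: "Bs \<subseteq> L" "real_functions.independent Bs" "L \<subseteq> real_functions.span Bs"
    using real_functions.maximal_independent_subset[of L] by blast
  have finB: "finite Bs"
    using real_functions.independent_span_bound[OF D(1) Bs(2)] Bs(1) D(2) by blast
  have repr: "\<exists>r. l = (\<lambda>h. \<Sum>b\<in>Bs. of_real (r b) * b h)" if "l \<in> L" for l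
  proof -
    have "l \<in> range (\<lambda>u. \<Sum>v\<in>Bs. rscale (u v) v)"
      using that Bs(3) real_functions.span_finite[OF finB] by blast
    then show ?thesis by (auto simp: fun_eq_iff sum_fun_apply rscale_def)
  qed
  define C where "C = {l\<in>L. \<forall>h. cmod (l h) \<le> (\<Sum>b\<in>Bs. cmod (b h))}"
  \<comment> \<open>Records the square cell of side \<open>e / 2\<close> that contains each value on
    \<open>F\<close>. The bound defining \<open>C\<close> leaves finitely many cells, and elements
    in the same cells differ by less than \<open>e\<close> on \<open>F\<close>, hence
    coincide.\<close>
  define code where "code l = (\<lambda>h\<in>F. (\<lfloor>Re (l h) * (2 / e)\<rfloor>, \<lfloor>Im (l h) * (2 / e)\<rfloor>))" for l
  define M where "M h = (\<Sum>b\<in>Bs. cmod (b h)) * (2 / e)" for h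
  have fl: "\<lfloor>t * (2 / e)\<rfloor> \<in> {\<lfloor>- M h\<rfloor>..\<lfloor>M h\<rfloor>}" if "\<bar>t\<bar> \<le> (\<Sum>b\<in>Bs. cmod (b h))" for t h
  proof -
    have "\<bar>t * (2 / e)\<bar> \<le> M h"
      using that F(2) by (simp add: M_def abs_mult divide_simps)
    then have "- M h \<le> t * (2 / e)" "t * (2 / e) \<le> M h" by linarith+
    then show ?thesis using floor_mono by (metis atLeastAtMost_iff)
  qed
  have "code ` C \<subseteq> (\<Pi>\<^sub>E h\<in>F. {\<lfloor>- M h\<rfloor>..\<lfloor>M h\<rfloor>} \<times> {\<lfloor>- M h\<rfloor>..\<lfloor>M h\<rfloor>})"
  proof (rule image_subsetI)
    fix l assume "l \<in> C"
    then have "\<bar>Re (l h)\<bar> \<le> (\<Sum>b\<in>Bs. cmod (b h))" "\<bar>Im (l h)\<bar> \<le> (\<Sum>b\<in>Bs. cmod (b h))" for h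
      unfolding C_def using abs_Re_le_cmod abs_Im_le_cmod order_trans by blast+
    then show "code l \<in> (\<Pi>\<^sub>E h\<in>F. {\<lfloor>- M h\<rfloor>..\<lfloor>M h\<rfloor>} \<times> {\<lfloor>- M h\<rfloor>..\<lfloor>M h\<rfloor>})"
      unfolding code_def using fl by (auto simp del: atLeastAtMost_iff)
  qed
  moreover have "finite (\<Pi>\<^sub>E h\<in>F. {\<lfloor>- M h\<rfloor>..\<lfloor>M h\<rfloor>} \<times> {\<lfloor>- M h\<rfloor>..\<lfloor>M h\<rfloor>})"
    using F(1) by (intro finite_PiE) auto
  ultimately have "finite (code ` C)" using finite_subset by blast
  moreover have "inj_on code C"
  proof (rule inj_onI)
    fix l m assume lm: "l \<in> C" "m \<in> C" "code l = code m"
    have close: "\<bar>t - u\<bar> < e / 2" if "\<lfloor>t * (2 / e)\<rfloor> = \<lfloor>u * (2 / e)\<rfloor>" for t u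
    proof -
      have "\<bar>t * (2 / e) - u * (2 / e)\<bar> < 1" using that by linarith
      then have "\<bar>(t - u) * (2 / e)\<bar> < 1" by (simp only: left_diff_distrib)
      then have "\<bar>t - u\<bar> * (2 / e) < 1" using F(2) by (simp only: abs_mult) simp
      then show ?thesis using F(2) by (simp add: field_simps)
    qed
    have "cmod ((l - m) h) < e" if "h \<in> F" for h
    proof -
      have "code l h = code m h" using lm by simp
      then have "\<bar>Re (l h) - Re (m h)\<bar> < e / 2" "\<bar>Im (l h) - Im (m h)\<bar> < e / 2"
        using that close unfolding code_def by auto
      then show ?thesis using cmod_le[of "l h - m h"] by simp
    qed
    moreover have "l - m \<in> L" using lm L by (auto simp: C_def additive_subgroupD)
    ultimately have "l - m = 0" using iso by blast
    then show "l = m" by simp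
  qed
  ultimately have finC: "finite C" using finite_imageD by blast
  have "zspan (Bs \<union> C) = L"
  proof
    show "zspan (Bs \<union> C) \<subseteq> L" using Bs by (intro zspan_least[OF L]) (auto simp: C_def)
    show "L \<subseteq> zspan (Bs \<union> C)"
    proof
      fix l assume l: "l \<in> L"
      obtain r where r: "l = (\<lambda>h. \<Sum>b\<in>Bs. of_real (r b) * b h)" using repr[OF l] by blast
      define m where "m = (\<lambda>h. \<Sum>b\<in>Bs. of_int \<lfloor>r b\<rfloor> * b h)"
      have m: "m \<in> zspan Bs" unfolding m_def by (rule zspanI) (use finB in auto)
      then have "m \<in> L" using zspan_least[OF L Bs(1)] by blast
      then have "l - m \<in> L" using l L by (simp add: additive_subgroupD)
      moreover have "cmod ((l - m) h) \<le> (\<Sum>b\<in>Bs. cmod (b h))" for h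
      proof -
        have "(l - m) h = (\<Sum>b\<in>Bs. of_real (frac (r b)) * b h)"
          by (simp add: r m_def frac_def sum_subtractf[symmetric] algebra_simps)
        also have "cmod \<dots> \<le> (\<Sum>b\<in>Bs. cmod (of_real (frac (r b)) * b h))" by (rule norm_sum)
        also have "\<dots> \<le> (\<Sum>b\<in>Bs. cmod (b h))"
          by (intro sum_mono)
            (simp add: norm_mult mult_left_le_one_le frac_ge_0 less_imp_le[OF frac_lt_1])
        finally show ?thesis .
      qed
      ultimately have "l - m \<in> zspan (Bs \<union> C)" by (intro zspan_base) (simp add: C_def)
      moreover have "m \<in> zspan (Bs \<union> C)"
        using m zspan_base[of _ "Bs \<union> C"] zspan_subset_iff[of Bs "Bs \<union> C"] by blast
      ultimately show "l \<in> zspan (Bs \<union> C)" using zspan_add by fastforce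
    qed
  qed
  then show ?thesis using finB finC by (intro exI[of _ "Bs \<union> C"]) auto
qed

section \<open>Root spaces and nonisotropic roots\<close>

lemma (in module) span_UN_subspaces:
  assumes sub: "\<And>i. i \<in> I \<Longrightarrow> subspace (W i)" and x: "x \<in> span (\<Union>i\<in>I. W i)"
  shows "\<exists>F v. finite F \<and> F \<subseteq> I \<and> (\<forall>i\<in>F. v i \<in> W i) \<and> x = (\<Sum>i\<in>F. v i)"
  using x
proof (induct rule: span_induct_alt)
  case base
  show ?case by (intro exI[of _ "{}"]) auto
next
  case (step c u y)
  then obtain F v where F: "finite F" "F \<subseteq> I" "\<forall>i\<in>F. v i \<in> W i" "y = (\<Sum>i\<in>F. v i)" by blast
  obtain j where j: "j \<in> I" "u \<in> W j" using step(1) by blast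
  \<comment> \<open>The index \<open>j\<close> may already occur in \<open>F\<close>; its two
    contributions are merged.\<close>
  define v' where "v' i = (if i \<in> F then v i else 0) + (if i = j then c *s u else 0)" for i
  have "v' i \<in> W i" if "i \<in> insert j F" for i
    using that F j sub[of i] subspace_0[OF sub[of i]] subspace_scale[OF sub[OF j(1)] j(2), of c]
      subspace_add[OF sub[of i]]
    by (auto simp: v'_def)
  moreover have "c *s u + y = (\<Sum>i\<in>insert j F. v' i)"
  proof -
    have "(\<Sum>i\<in>insert j F. if i \<in> F then v i else 0) = y"
      unfolding F(4) using F(1) by (intro sum.mono_neutral_cong_right) auto
    moreover have "(\<Sum>i\<in>insert j F. if i = j then c *s u else 0) = c *s u"
      using F(1) by (simp add: sum.delta)
    ultimately show ?thesis by (simp add: v'_def sum.distrib add.commute)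
  qed
  ultimately show ?case using F j by (intro exI[of _ "insert j F"] exI[of _ v']) auto
qed

definition cscale :: "complex \<Rightarrow> 'a functional \<Rightarrow> 'a functional" where
  "cscale c a = (\<lambda>h. c * a h)"

lemma cscale_simps [simp]:
  "cscale 1 a = a" "cscale 0 a = 0" "cscale c 0 = 0" "cscale (-1) a = - a"
  "cscale c a h = c * a h" "cscale c (cscale d a) = cscale (c * d) a"
  by (auto simp: cscale_def)

locale generalized_reductive =
  fixes sg :: "complex \<Rightarrow> 'g::ab_group_add \<Rightarrow> 'g"
    and br :: "'g \<Rightarrow> 'g \<Rightarrow> 'g"
    and B :: "'g \<Rightarrow> 'g \<Rightarrow> complex"
    and H :: "'g set"
  assumes grla: "grla sg br B H"
begin

abbreviation D where "D \<equiv> dual sg H"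
abbreviation G where "G \<equiv> root_space br sg H"
abbreviation R where "R \<equiv> roots br sg H"
abbreviation Rx where "Rx \<equiv> nonisotropic_roots br sg B H"
abbreviation R0 where "R0 \<equiv> isotropic_roots br sg B H"
abbreviation tv where "tv \<equiv> tvec B H"
abbreviation ip where "ip \<equiv> fform B H"

lemmas grla_tail_1 = grla[unfolded grla_def, THEN conjunct2]
lemmas grla_tail_2 = grla_tail_1[THEN conjunct2]
lemmas grla_tail_3 = grla_tail_2[THEN conjunct2]
lemmas grla_tail_4 = grla_tail_3[THEN conjunct2]
lemmas grla_tail_5 = grla_tail_4[THEN conjunct2]
lemmas grla_tail_6 = grla_tail_5[THEN conjunct2]
lemmas grla_tail_7 = grla_tail_6[THEN conjunct2]
lemmas grla_tail_8 = grla_tail_7[THEN conjunct2]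
lemmas grla_tail_9 = grla_tail_8[THEN conjunct2]
lemmas grla_tail_10 = grla_tail_9[THEN conjunct2]
lemmas grla_tail_11 = grla_tail_10[THEN conjunct2]
lemmas grla_tail_12 = grla_tail_11[THEN conjunct2]

section \<open>Bilinearity of the bracket and the form\<close>

lemma lie: "lie_algebra sg br"
  using grla unfolding grla_def by blast

sublocale V: vector_space sg
  using lie unfolding lie_algebra_def by blast

lemma br_comb: "br (sg c x + y) z = sg c (br x z) + br y z"
  and br_self [simp]: "br x x = 0"
  and jacobi: "br x (br y z) + br y (br z x) + br z (br x y) = 0"
  using lie unfolding lie_algebra_def by blast+

lemma br_add_left: "br (x + y) z = br x z + br y z"
  using br_comb[of 1 x y z] by simp

lemma br_zero_left [simp]: "br 0 z = 0"
  using br_add_left[of 0 0 z] by simp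

lemma br_scale_left: "br (sg c x) z = sg c (br x z)"
  using br_comb[of c x 0 z] by simp

lemma B_sym: "B x y = B y x"
  and B_comb: "B (sg c x + y) z = c * B x z + B y z"
  and B_inv: "B (br x y) z = B x (br y z)"
  using grla_tail_1[THEN conjunct1] grla_tail_2[THEN conjunct1] grla_tail_4[THEN conjunct1]
  by blast+

lemma B_nondegenerate: "(\<And>y. B x y = 0) \<Longrightarrow> x = 0"
  using grla_tail_3[THEN conjunct1] by blast

lemma B_add: "B (x + y) z = B x z + B y z" "B z (x + y) = B z x + B z y"
  using B_comb[of 1 x y z] B_sym by simp_all

lemma B_zero [simp]: "B 0 z = 0" "B z 0 = 0"
  using B_add(1)[of 0 0 z] B_sym by simp_all

lemma B_scale: "B (sg c x) z = c * B x z" "B z (sg c x) = c * B z x"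
  using B_comb[of c x 0 z] B_sym by simp_all

lemma B_neg: "B (- x) z = - B x z" "B z (- x) = - B z x"
  using B_add(1)[of x "- x" z] B_sym by (simp_all add: eq_neg_iff_add_eq_0 add.commute)

lemma B_diff: "B (x - y) z = B x z - B y z" "B z (x - y) = B z x - B z y"
  using B_add[of x "- y" z] B_add[of z x "- y"] by (simp_all add: B_neg)

lemma B_eqI: "(\<And>z. B x z = B y z) \<Longrightarrow> x = y"
  using B_nondegenerate[of "x - y"] by (simp add: B_diff)

text \<open>The definition of a Lie algebra only asks for linearity in the first argument; invariance
  of the nondegenerate form gives it in the second.\<close>
lemma br_comb_right: "br x (sg c y + z) = sg c (br x y) + br x z"
  by (rule B_eqI) (simp add: B_inv br_comb B_add B_scale)

lemma br_add_right: "br x (y + z) = br x y + br x z"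
  using br_comb_right[of x 1 y z] by simp

lemma br_zero_right [simp]: "br x 0 = 0"
  using br_add_right[of x 0 0] by simp

lemma br_scale_right: "br x (sg c y) = sg c (br x y)"
  using br_comb_right[of x c y 0] by simp

lemma br_anti: "br x y = - br y x"
proof -
  have "br x y + br y x = br (x + y) (x + y)"
    by (simp only: br_add_left br_add_right) simp
  then show ?thesis by (simp add: eq_neg_iff_add_eq_0)
qed

lemma br_neg: "br (- x) y = - br x y" "br x (- y) = - br x y"
  using br_add_left[of x "- x" y] br_add_right[of x y "- y"]
  by (simp_all add: eq_neg_iff_add_eq_0 add.commute)

lemma br_diff: "br (x - y) z = br x z - br y z" "br x (y - z) = br x y - br x z"
  using br_add_left[of x "- y" z] br_add_right[of x y "- z"] by (simp_all add: br_neg)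

lemma br_sum_right: "br x (\<Sum>i\<in>F. v i) = (\<Sum>i\<in>F. br x (v i))"
  by (induct F rule: infinite_finite_induct) (auto simp: br_add_right)

lemma br_sum_left: "br (\<Sum>i\<in>F. v i) x = (\<Sum>i\<in>F. br (v i) x)"
  by (induct F rule: infinite_finite_induct) (auto simp: br_add_left)

lemma B_sum_right: "B x (\<Sum>i\<in>F. v i) = (\<Sum>i\<in>F. B x (v i))"
  by (induct F rule: infinite_finite_induct) (auto simp: B_add)

lemma br_derivation: "br x (br y z) = br (br x y) z + br y (br x z)"
proof -
  have "br x (br y z) + (- br y (br x z)) + (- br (br x y) z) = 0"
    using jacobi[of x y z] br_anti[of z x] br_anti[of z "br x y"] by (simp add: br_neg)
  then show ?thesis by (simp add: algebra_simps)
qed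

lemma br_derivation_left: "br (br x y) z = br x (br y z) - br y (br x z)"
  using br_derivation[of x y z] by simp

lemma H_subspace: "V.subspace H"
  and H_finite_dim: "\<exists>S. finite S \<and> H = V.span S"
  and H_centralizer: "{x. \<forall>h\<in>H. br h x = 0} = H"
  and H_diagonalizable: "h \<in> H \<Longrightarrow> V.span {x. \<exists>c. br h x = sg c x} = UNIV"
  using grla_tail_5[THEN conjunct1]
    grla_tail_7[THEN conjunct1]
    grla_tail_9[THEN conjunct1]
    grla_tail_10[THEN conjunct1]
  by blast+

lemma H_abelian: "h \<in> H \<Longrightarrow> k \<in> H \<Longrightarrow> br h k = 0"
  using H_centralizer by blast

lemma ad_nilpotent: "a \<in> Rx \<Longrightarrow> x \<in> G a \<Longrightarrow> \<exists>n. (br x ^^ n) y = 0"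
  using grla_tail_11[THEN conjunct1] by blast

lemma R_discrete:
  "a \<in> R \<Longrightarrow> \<exists>F e. finite F \<and> F \<subseteq> H \<and> e > (0::real) \<and>
        (\<forall>b\<in>R. (\<forall>h\<in>F. cmod (b h - a h) < e) \<longrightarrow> b = a)"
  using grla_tail_12[THEN conjunct1] by blast

section \<open>Simultaneous diagonalization and the root space decomposition\<close>

lemma joint_eigenvectors_independent:
  assumes "finite F"
    and "\<And>i j. i \<in> F \<Longrightarrow> j \<in> F \<Longrightarrow> i \<noteq> j \<Longrightarrow> \<exists>h\<in>A. \<phi> i h \<noteq> \<phi> j h"
    and "\<And>i h. i \<in> F \<Longrightarrow> h \<in> A \<Longrightarrow> br h (v i) = sg (\<phi> i h) (v i)"
    and "(\<Sum>i\<in>F. v i) = 0" and "i \<in> F"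
  shows "v i = 0"
  using assms
proof (induct F arbitrary: v i rule: finite_induct)
  case (insert a F)
  have F0: "v b = 0" if b: "b \<in> F" for b
  proof -
    obtain h where h: "h \<in> A" "\<phi> b h \<noteq> \<phi> a h"
      using insert.prems(1)[of b a] insert.hyps b by blast
    \<comment> \<open>The effect of \<open>br h\<close> minus the scalar \<open>\<phi> a h\<close>:
      the summand at \<open>a\<close> is annihilated and the one at \<open>b\<close> multiplied by a
      nonzero number, so the induction hypothesis applies to \<open>F\<close>.\<close>
    define w where "w c = sg (\<phi> c h - \<phi> a h) (v c)" for c
    have "(\<Sum>c\<in>F. w c) = (\<Sum>c\<in>insert a F. w c)"
      using insert.hyps by (simp add: w_def)
    also have "\<dots> = (\<Sum>c\<in>insert a F. br h (v c) - sg (\<phi> a h) (v c))"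
      using insert.prems(2) h by (intro sum.cong) (auto simp: w_def V.scale_left_diff_distrib)
    also have "\<dots> = br h (\<Sum>c\<in>insert a F. v c) - sg (\<phi> a h) (\<Sum>c\<in>insert a F. v c)"
      by (simp add: sum_subtractf br_sum_right V.scale_sum_right del: sum.insert)
    also have "\<dots> = 0" using insert.prems(3) by simp
    finally have "(\<Sum>c\<in>F. w c) = 0" .
    moreover have "br k (w c) = sg (\<phi> c k) (w c)" if "c \<in> F" "k \<in> A" for c k
      using insert.prems(2) that by (simp add: w_def br_scale_right V.scale_left_commute)
    ultimately have "w b = 0"
      using insert.hyps(3)[of w b] insert.prems(1) b by blast
    then show ?thesis using h by (simp add: w_def)
  qed
  then have "(\<Sum>c\<in>F. v c) = 0" by (intro sum.neutral) blast
  then have "v a = 0" using insert.prems(3) insert.hyps by simp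
  then show ?case using F0 insert.prems(4) by blast
qed auto

lemma root_space_memI: "(\<And>h. h \<in> H \<Longrightarrow> br h x = sg (a h) x) \<Longrightarrow> x \<in> G a"
  by (simp add: root_space_def)

lemma root_spaceD: "x \<in> G a \<Longrightarrow> h \<in> H \<Longrightarrow> br h x = sg (a h) x"
  by (simp add: root_space_def)

lemma root_space_subspace: "V.subspace (G a)"
  unfolding V.subspace_def root_space_def
  by (auto simp: br_add_right br_scale_right V.scale_right_distrib V.scale_left_commute)

lemma root_space_zero: "G 0 = H"
  using H_centralizer by (simp add: root_space_def)

lemma dual_comb: "a \<in> D \<Longrightarrow> h \<in> H \<Longrightarrow> k \<in> H \<Longrightarrow> a (sg c h + k) = c * a h + a k"
  by (simp add: dual_def)

lemma dual_outside: "a \<in> D \<Longrightarrow> x \<notin> H \<Longrightarrow> a x = 0"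
  by (simp add: dual_def)

lemma dual_ext: "a \<in> D \<Longrightarrow> b \<in> D \<Longrightarrow> (\<And>h. h \<in> H \<Longrightarrow> a h = b h) \<Longrightarrow> a = b"
  using dual_outside by (metis ext)

lemma dual_subgroup: "additive_subgroup D"
  unfolding additive_subgroup_def dual_def by (auto simp: algebra_simps)

lemma dual_cscale: "a \<in> D \<Longrightarrow> cscale c a \<in> D"
  unfolding dual_def by (auto simp: algebra_simps)

lemmas dual_closed [simp] = additive_subgroupD[OF dual_subgroup] dual_cscale

lemma root_spaces_independent:
  assumes "finite F" "inj_on \<phi> F" "\<And>i. i \<in> F \<Longrightarrow> \<phi> i \<in> D" "\<And>i. i \<in> F \<Longrightarrow> v i \<in> G (\<phi> i)"
    "(\<Sum>i\<in>F. v i) = 0" "i \<in> F"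
  shows "v i = 0"
proof (rule joint_eigenvectors_independent[where A = H and \<phi> = \<phi> and F = F])
  show "\<exists>h\<in>H. \<phi> i h \<noteq> \<phi> j h" if "i \<in> F" "j \<in> F" "i \<noteq> j" for i j
    using that assms(2,3) dual_ext by (metis inj_onD)
qed (use assms root_spaceD in auto)

text \<open>Commuting operators preserve each other's eigenspaces. When a joint eigenvector of
  \<open>S\<close> is split along the eigenvalues of \<open>br h\<close>, the defects
  \<open>br k (v c) - d v c\<close> are eigenvectors for distinct eigenvalues with sum zero, so they
  vanish and every component stays a joint eigenvector.\<close>

lemma finite_joint_diagonalization:
  assumes "finite S" "S \<subseteq> H"
  shows "V.span {x. \<forall>h\<in>S. \<exists>c. br h x = sg c x} = UNIV"
  using assms
proof (induct S rule: finite_induct)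
  case empty
  then show ?case by simp
next
  case (insert h S)
  define E where "E = {x. \<forall>k\<in>insert h S. \<exists>c. br k x = sg c x}"
  have "x \<in> V.span E" if x: "\<forall>k\<in>S. \<exists>c. br k x = sg c x" for x
  proof -
    have sub: "V.subspace {y. br h y = sg c y}" for c
      unfolding V.subspace_def
      by (auto simp: br_add_right br_scale_right V.scale_right_distrib V.scale_left_commute)
    have "{y. \<exists>c. br h y = sg c y} = (\<Union>c. {y. br h y = sg c y})" by blast
    then have "x \<in> V.span (\<Union>c. {y. br h y = sg c y})"
      using H_diagonalizable[of h] insert.prems by simp
    from V.span_UN_subspaces[OF sub this] obtain F v
      where F: "finite F" "\<And>c. c \<in> F \<Longrightarrow> br h (v c) = sg c (v c)" "x = (\<Sum>c\<in>F. v c)" by auto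
    have "\<exists>d. br k (v c) = sg d (v c)" if c: "c \<in> F" and k: "k \<in> S" for c k
    proof -
      obtain d where d: "br k x = sg d x" using x k by blast
      define w where "w c = br k (v c) - sg d (v c)" for c
      have "(\<Sum>c\<in>F. w c) = 0"
        using d by (simp add: w_def sum_subtractf F(3) br_sum_right V.scale_sum_right)
      moreover have "br h (w c) = sg c (w c)" if "c \<in> F" for c
      proof -
        have "br h (br k (v c)) = br k (br h (v c))"
          using br_derivation[of h k "v c"] H_abelian insert.prems k by auto
        then show ?thesis using F(2)[OF that]
          by (simp add: w_def br_diff br_scale_right V.scale_right_diff_distrib V.scale_left_commute)
      qed
      ultimately have "w c = 0"
        using joint_eigenvectors_independent[of F "{h}" "\<lambda>c _. c" w c] F(1) c by auto
      then show ?thesis by (auto simp: w_def)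
    qed
    then have "v c \<in> E" if "c \<in> F" for c using that F(2) unfolding E_def by auto
    then show ?thesis unfolding F(3) by (intro V.span_sum V.span_base)
  qed
  then have "V.span {x. \<forall>h\<in>S. \<exists>c. br h x = sg c x} \<subseteq> V.span E"
    by (intro V.span_minimal) auto
  then show ?case using insert by (auto simp: E_def)
qed

lemma root_decomposition: "V.span (\<Union>a\<in>D. G a) = UNIV"
proof -
  obtain S where S: "finite S" "H = V.span S" using H_finite_dim by blast
  then have SH: "S \<subseteq> H" using V.span_superset by blast
  have "x \<in> (\<Union>a\<in>D. G a)" if x: "\<forall>h\<in>S. \<exists>c. br h x = sg c x" for x
  proof (cases "x = 0")
    case True
    then show ?thesis using dual_closed(1) V.subspace_0[OF root_space_subspace] by blast
  next
    case False
    have "V.subspace {h. \<exists>c. br h x = sg c x}"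
      unfolding V.subspace_def
    proof (safe)
      show "\<exists>c. br 0 x = sg c x" by (intro exI[of _ 0]) simp
      fix h k c d
      show "br h x = sg c x \<Longrightarrow> \<exists>d. br (sg e h) x = sg d x" for e
        by (intro exI[of _ "e * c"]) (simp add: br_scale_left)
      show "br h x = sg c x \<Longrightarrow> br k x = sg d x \<Longrightarrow> \<exists>c. br (h + k) x = sg c x"
        by (intro exI[of _ "c + d"]) (simp add: br_add_left V.scale_left_distrib)
    qed
    then have ex: "\<exists>c. br h x = sg c x" if "h \<in> H" for h
      using V.span_minimal[of S "{h. \<exists>c. br h x = sg c x}"] x that S by blast
    \<comment> \<open>The eigenvalue is unique because \<open>x \<noteq> 0\<close>, which makes
      \<open>a\<close> linear on \<open>H\<close>; the value 0 elsewhere is the convention of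
      \<open>dual\<close>.\<close>
    define a where "a h = (if h \<in> H then SOME c. br h x = sg c x else 0)" for h
    have a: "br h x = sg (a h) x" if "h \<in> H" for h
      using someI_ex[OF ex[OF that]] that by (simp add: a_def)
    have "a (sg c h + k) = c * a h + a k" if "h \<in> H" "k \<in> H" for c h k
    proof -
      have "sg (a (sg c h + k)) x = br (sg c h + k) x"
        using that H_subspace V.subspace_add V.subspace_scale by (metis a)
      also have "\<dots> = sg (c * a h + a k) x"
        using that by (simp add: br_comb a V.scale_left_distrib)
      finally show ?thesis using False by simp
    qed
    then have "a \<in> D" by (auto simp: dual_def a_def)
    then show ?thesis using a root_space_memI by blast
  qed
  then have "{x. \<forall>h\<in>S. \<exists>c. br h x = sg c x} \<subseteq> (\<Union>a\<in>D. G a)" by blast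
  from V.span_mono[OF this] show ?thesis using finite_joint_diagonalization[OF S(1) SH] by blast
qed

lemma obtain_root_decomposition:
  obtains F v where "finite F" "F \<subseteq> D" "\<And>a. a \<in> F \<Longrightarrow> v a \<in> G a" "x = (\<Sum>a\<in>F. v a)"
proof -
  have "x \<in> V.span (\<Union>a\<in>D. G a)" using root_decomposition by simp
  from V.span_UN_subspaces[OF root_space_subspace this] show ?thesis using that by blast
qed

section \<open>The form on root spaces and on functionals\<close>

lemma B_root_spaces_orthogonal:
  assumes "x \<in> G a" "y \<in> G b" "a \<in> D" "b \<in> D" "a + b \<noteq> 0"
  shows "B x y = 0"
proof -
  have "\<exists>h\<in>H. (a + b) h \<noteq> 0"
    using dual_ext[of "a + b" 0] assms by auto
  then obtain h where h: "h \<in> H" "a h + b h \<noteq> 0" by auto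
  have "a h * B x y = B (br h x) y" using root_spaceD[OF assms(1) h(1)] by (simp add: B_scale)
  also have "\<dots> = - B x (br h y)" by (simp add: br_anti[of h x] B_neg B_inv)
  also have "\<dots> = - (b h * B x y)" using root_spaceD[OF assms(2) h(1)] by (simp add: B_scale)
  finally have "(a h + b h) * B x y = 0" by (simp add: algebra_simps)
  then show ?thesis using h(2) by simp
qed

text \<open>Nondegeneracy yields some vector pairing nontrivially with \<open>x\<close>;
  orthogonality discards all its components except the one in \<open>G (- a)\<close>. The case
  \<open>a = 0\<close> is nondegeneracy on \<open>H\<close>.\<close>

lemma root_space_pairing:
  assumes "x \<in> G a" "a \<in> D" "x \<noteq> 0"
  shows "\<exists>y\<in>G (- a). B x y = 1"
proof -
  obtain y where y: "B x y \<noteq> 0" using B_nondegenerate assms(3) by blast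
  obtain F v where F: "finite F" "F \<subseteq> D" "\<And>a. a \<in> F \<Longrightarrow> v a \<in> G a" "y = (\<Sum>a\<in>F. v a)"
    using obtain_root_decomposition by blast
  obtain b where b: "b \<in> F" "B x (v b) \<noteq> 0"
    using y unfolding F(4) B_sum_right by (meson sum.neutral)
  then have "a + b = 0" using B_root_spaces_orthogonal[OF assms(1) F(3)] assms F by blast
  then have "b = - a" by (simp add: eq_neg_iff_add_eq_0 add.commute)
  then have "sg (1 / B x (v b)) (v b) \<in> G (- a)"
    using F(3)[OF b(1)] V.subspace_scale[OF root_space_subspace] by blast
  then show ?thesis using b by (intro bexI[of _ "sg (1 / B x (v b)) (v b)"]) (auto simp: B_scale)
qed

lemma H_nondegenerate:
  assumes "h \<in> H" "\<And>k. k \<in> H \<Longrightarrow> B h k = 0"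
  shows "h = 0"
  using root_space_pairing[of h 0] assms root_space_zero by fastforce

lemma root_space_br: "x \<in> G a \<Longrightarrow> y \<in> G b \<Longrightarrow> br x y \<in> G (a + b)"
  by (rule root_space_memI)
    (simp add: br_derivation[of _ x y] root_spaceD br_scale_left br_scale_right V.scale_left_distrib)

lemma root_space_br_funpow:
  assumes "x \<in> G a" "y \<in> G b"
  shows "(br x ^^ n) y \<in> G (b + cscale (of_nat n) a)"
proof (induct n)
  case (Suc n)
  have "a + (b + cscale (of_nat n) a) = b + cscale (of_nat (Suc n)) a"
    by (rule ext) (simp add: algebra_simps)
  then show ?case using root_space_br[OF assms(1) Suc] by (simp only: funpow.simps o_apply)
qed (use assms in simp)

text \<open>The functionals represented by a vector of \<open>H\<close>, on which
  \<open>fform\<close> is bilinear. Every root \<open>a\<close> belongs here: if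
  \<open>B x y = 1\<close> for \<open>x\<close>, \<open>y\<close> in the root spaces of
  \<open>a\<close> and \<open>- a\<close>, then \<open>br x y\<close> represents
  \<open>a\<close>.\<close>

definition Dt where "Dt = {a \<in> D. \<exists>t\<in>H. \<forall>h\<in>H. B t h = a h}"

lemma tvec_eqI:
  assumes "t \<in> H" "\<And>h. h \<in> H \<Longrightarrow> B t h = a h"
  shows "tv a = t"
  unfolding tvec_def
proof (rule the_equality)
  fix s assume s: "s \<in> H \<and> (\<forall>h\<in>H. B s h = a h)"
  then have "s - t = 0"
    using assms V.subspace_diff[OF H_subspace] by (intro H_nondegenerate) (auto simp: B_diff)
  then show "s = t" by simp
qed (use assms in auto)

lemma tvec_props:
  assumes "a \<in> Dt"
  shows "tv a \<in> H" "h \<in> H \<Longrightarrow> B (tv a) h = a h"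
  using assms tvec_eqI unfolding Dt_def by force+

lemma DtI: "a \<in> D \<Longrightarrow> t \<in> H \<Longrightarrow> (\<And>h. h \<in> H \<Longrightarrow> B t h = a h) \<Longrightarrow> a \<in> Dt"
  unfolding Dt_def by blast

lemma Dt_dual [simp]: "a \<in> Dt \<Longrightarrow> a \<in> D"
  unfolding Dt_def by blast

lemma Dt_cscale [simp]: "a \<in> Dt \<Longrightarrow> cscale c a \<in> Dt"
  using tvec_props V.subspace_scale[OF H_subspace]
  by (intro DtI[of _ "sg c (tv a)"]) (auto simp: B_scale)

lemma Dt_add [simp]: "a \<in> Dt \<Longrightarrow> b \<in> Dt \<Longrightarrow> a + b \<in> Dt"
  using tvec_props V.subspace_add[OF H_subspace]
  by (intro DtI[of _ "tv a + tv b"]) (auto simp: B_add)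

lemma Dt_zero [simp]: "0 \<in> Dt"
  using V.subspace_0[OF H_subspace] by (intro DtI[of _ 0]) auto

lemma Dt_neg [simp]: "a \<in> Dt \<Longrightarrow> - a \<in> Dt"
  using Dt_cscale[of a "-1"] by simp

lemma Dt_subgroup: "additive_subgroup Dt"
  by (simp add: additive_subgroup_def)

lemma ip_eq:
  assumes "a \<in> Dt" "b \<in> Dt"
  shows "ip a b = a (tv b)" "ip a b = b (tv a)"
  using tvec_props[OF assms(1)] tvec_props[OF assms(2)] B_sym by (metis fform_def)+

lemma ip_sym: "ip a b = ip b a"
  by (simp add: fform_def B_sym)

lemma ip_add:
  assumes "a \<in> Dt" "b \<in> Dt" "c \<in> Dt"
  shows "ip (a + b) c = ip a c + ip b c" "ip c (a + b) = ip c a + ip c b"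
  using assms by (simp_all add: ip_eq(1)[of _ c] ip_eq(2)[of c])

lemma ip_cscale:
  assumes "a \<in> Dt" "c \<in> Dt"
  shows "ip (cscale k a) c = k * ip a c" "ip c (cscale k a) = k * ip c a"
  using assms by (simp_all add: ip_eq(1)[of _ c] ip_eq(2)[of c])

lemma ip_neg:
  assumes "a \<in> Dt" "c \<in> Dt"
  shows "ip (- a) c = - ip a c" "ip c (- a) = - ip c a"
  using assms by (simp_all add: ip_eq(1)[of _ c] ip_eq(2)[of c])

lemma ip_zero [simp]: "c \<in> Dt \<Longrightarrow> ip 0 c = 0" "c \<in> Dt \<Longrightarrow> ip c 0 = 0"
  by (simp_all add: ip_eq(1)[of _ c] ip_eq(2)[of c])

lemma br_opposite:
  assumes "x \<in> G a" "y \<in> G (- a)" "a \<in> D"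
  shows "br x y \<in> H" "h \<in> H \<Longrightarrow> B (br x y) h = a h * B x y"
proof -
  show "br x y \<in> H" using root_space_br[OF assms(1,2)] by (simp add: root_space_zero)
  show "B (br x y) h = a h * B x y" if "h \<in> H"
    using root_spaceD[OF assms(2) that] by (simp add: B_inv br_anti[of y h] B_neg B_scale)
qed

lemma rootI: "x \<in> G a \<Longrightarrow> a \<in> D \<Longrightarrow> x \<noteq> 0 \<Longrightarrow> a \<in> R"
  unfolding roots_def by blast

lemma root_obtain:
  assumes "a \<in> R" obtains x where "x \<in> G a" "x \<noteq> 0"
  using assms V.subspace_0[OF root_space_subspace] unfolding roots_def by blast

lemma R_dual [simp]: "a \<in> R \<Longrightarrow> a \<in> D"
  unfolding roots_def by blast

lemma R_neg: assumes "a \<in> R" shows "- a \<in> R"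
proof -
  obtain x where x: "x \<in> G a" "x \<noteq> 0" using assms root_obtain by blast
  then obtain y where "y \<in> G (- a)" "B x y = 1" using root_space_pairing[OF x(1)] assms by auto
  then show ?thesis using rootI[of y "- a"] assms by fastforce
qed

lemma R_Dt [simp]: assumes "a \<in> R" shows "a \<in> Dt"
proof -
  obtain x where x: "x \<in> G a" "x \<noteq> 0" using assms root_obtain by blast
  then obtain y where "y \<in> G (- a)" "B x y = 1" using root_space_pairing[OF x(1)] assms by auto
  then show ?thesis using br_opposite[OF x(1)] assms by (intro DtI[of a "br x y"]) auto
qed

lemma br_opposite_tvec:
  assumes "x \<in> G a" "y \<in> G (- a)" "a \<in> Dt"
  shows "br x y = sg (B x y) (tv a)"
proof -
  have "br x y - sg (B x y) (tv a) = 0"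
    using assms br_opposite[of x a y] tvec_props[of a]
      V.subspace_diff[OF H_subspace] V.subspace_scale[OF H_subspace]
    by (intro H_nondegenerate) (auto simp: B_diff B_scale)
  then show ?thesis by simp
qed

lemma br_tvec:
  assumes "v \<in> G b" "b \<in> Dt" "a \<in> Dt"
  shows "br (tv a) v = sg (ip b a) v"
  using root_spaceD[OF assms(1) tvec_props(1)[OF assms(3)]] ip_eq(1)[OF assms(2,3)] by simp

lemma RxD: assumes "a \<in> Rx" shows "a \<in> R" "a \<in> Dt" "ip a a \<noteq> 0"
  using assms unfolding nonisotropic_roots_def by auto

lemma R0D: assumes "a \<in> R0" shows "a \<in> R" "a \<in> Dt" "ip a a = 0"
  using assms unfolding isotropic_roots_def by auto

lemma RxI: "a \<in> R \<Longrightarrow> ip a a \<noteq> 0 \<Longrightarrow> a \<in> Rx"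
  unfolding nonisotropic_roots_def by auto

lemma R0I: "a \<in> R \<Longrightarrow> ip a a = 0 \<Longrightarrow> a \<in> R0"
  unfolding isotropic_roots_def by auto

lemma Rx_neg: "a \<in> Rx \<Longrightarrow> - a \<in> Rx"
  using RxD[of a] by (intro RxI) (auto simp: R_neg ip_neg)

section \<open>The \<open>sl_2\<close>-triples, root strings and reflections\<close>

lemma sl2_triple:
  assumes "a \<in> Rx" "x \<in> G a" "x \<noteq> 0"
  obtains f where "f \<in> G (- a)" "B x f \<noteq> 0"
    "\<And>b v. b \<in> Dt \<Longrightarrow> v \<in> G b \<Longrightarrow> br (br x f) v = sg (cartan ip b a) v"
proof -
  obtain y where y: "y \<in> G (- a)" "B x y = 1"
    using root_space_pairing[OF assms(2) _ assms(3)] RxD[OF assms(1)] by auto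
  \<comment> \<open>The factor makes \<open>br x f\<close> the coroot \<open>2 t_a / (a, a)\<close>,
    whose eigenvalue on \<open>G b\<close> is the Cartan number.\<close>
  define f where "f = sg (2 / ip a a) y"
  have f: "f \<in> G (- a)" using y V.subspace_scale[OF root_space_subspace] by (simp add: f_def)
  have Bf: "B x f = 2 / ip a a" using y by (simp add: f_def B_scale)
  have "br (br x f) v = sg (cartan ip b a) v" if "b \<in> Dt" "v \<in> G b" for b v
    using br_opposite_tvec[OF assms(2) f] br_tvec[OF that(2,1)] RxD[OF assms(1)] Bf
    by (simp add: br_scale_left cartan_def)
  then show ?thesis using that f Bf RxD[OF assms(1)] by simp
qed

text \<open>If \<open>v\<close> is a lowest weight vector of weight \<open>l\<close> for \<open>\<langle>e, br e f, f\<rangle>\<close>, then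
  \<open>f e\<^sup>n\<^sup>+\<^sup>1 v = - (n + 1) (l + n) e\<^sup>n v\<close>, so local nilpotency of \<open>e\<close> forces \<open>l\<close> to be
  a nonpositive integer.\<close>
lemma lowest_weight:
  assumes v: "v \<noteq> 0" "br f v = 0" "br (br e f) v = sg l v"
    and e: "br (br e f) e = sg 2 e" and nil: "(br e ^^ N) v = 0"
  shows "\<exists>m::nat. l = - of_nat m \<and> (\<forall>j\<le>m. (br e ^^ j) v \<noteq> 0)"
proof -
  let ?v = "\<lambda>n. (br e ^^ n) v"
  have wt: "br (br e f) (?v n) = sg (l + 2 * of_nat n) (?v n)" for n
  proof (induct n)
    case (Suc n)
    have "br (br e f) (br e (?v n)) = br (br (br e f) e) (?v n) + br e (br (br e f) (?v n))"
      by (rule br_derivation)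
    also have "\<dots> = sg (2 + (l + 2 * of_nat n)) (?v (Suc n))"
      by (simp only: e Suc br_scale_left br_scale_right br_add_right V.scale_left_distrib funpow.simps o_apply)
    also have "2 + (l + 2 * of_nat n) = l + 2 * of_nat (Suc n)" by simp
    finally show ?case by (simp only: funpow.simps o_apply)
  qed (use v in simp)
  have lower: "br f (?v (Suc n)) = sg (- (of_nat n + 1) * (l + of_nat n)) (?v n)" for n
  proof (induct n)
    case 0
    have "br f (br e v) = - br (br e f) v + br e (br f v)"
      using br_derivation[of f e v] br_anti[of f e] by (simp add: br_neg)
    then show ?case using v by (simp add: V.scale_minus_left)
  next
    case (Suc n)
    have "br f (br e (?v (Suc n))) = - br (br e f) (?v (Suc n)) + br e (br f (?v (Suc n)))"
      using br_derivation[of f e "?v (Suc n)"] br_anti[of f e] by (simp add: br_neg)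
    also have "\<dots> = sg (- (l + 2 * of_nat (Suc n))) (?v (Suc n))
        + sg (- (of_nat n + 1) * (l + of_nat n)) (?v (Suc n))"
      by (simp only: Suc wt br_scale_right V.scale_minus_left) simp
    also have "\<dots> = sg (- (of_nat (Suc n) + 1) * (l + of_nat (Suc n))) (?v (Suc n))"
      by (simp only: V.scale_left_distrib[symmetric]) (simp add: algebra_simps)
    finally show ?case by simp
  qed
  define M where "M = (LEAST n. ?v n = 0)"
  have M: "?v M = 0" unfolding M_def using nil by (rule LeastI)
  have below: "?v j \<noteq> 0" if "j < M" for j
    using that not_less_Least unfolding M_def by blast
  obtain m where m: "M = Suc m" using M v(1) by (cases M) auto
  have "sg (- (of_nat m + 1) * (l + of_nat m)) (?v m) = 0"
    using lower[of m] M m by (metis br_zero_right)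
  moreover have "?v m \<noteq> 0" using below m by simp
  moreover have "- (of_nat m + 1) \<noteq> (0 :: complex)"
    unfolding neg_equal_0_iff_equal by (metis of_nat_Suc of_nat_neq_0 add.commute)
  ultimately have "l + of_nat m = 0" by (simp only: V.scale_eq_0_iff mult_eq_0_iff simp_thms)
  then have "l = - of_nat m" by (simp add: eq_neg_iff_add_eq_0)
  then show ?thesis using below m by auto
qed

lemma cartan_self: "a \<in> Rx \<Longrightarrow> cartan ip a a = 2"
  using RxD by (simp add: cartan_def)

text \<open>Local nilpotency of \<open>f\<close> ends the descent from \<open>b\<close> after
  \<open>k\<close> steps at a lowest weight vector. Its weight \<open>cartan ip b a - 2 k\<close> is
  some \<open>- m\<close> by \<open>lowest_weight\<close>, and climbing back with \<open>e\<close>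
  meets \<open>m + 1\<close> roots.\<close>

lemma root_string:
  assumes a: "a \<in> Rx" and b: "b \<in> R"
  shows "\<exists>k m::nat. cartan ip b a = 2 * of_nat k - of_nat m \<and>
    (\<forall>j\<le>m. b + cscale (of_nat j - of_nat k) a \<in> R)"
proof -
  obtain e where e: "e \<in> G a" "e \<noteq> 0" using RxD[OF a] root_obtain by blast
  obtain f where f: "f \<in> G (- a)"
    "\<And>b v. b \<in> Dt \<Longrightarrow> v \<in> G b \<Longrightarrow> br (br e f) v = sg (cartan ip b a) v"
    using sl2_triple[OF a e] by metis
  obtain v where v: "v \<in> G b" "v \<noteq> 0" using b root_obtain by blast
  define K where "K = (LEAST n. (br f ^^ n) v = 0)"
  have K: "(br f ^^ K) v = 0"
    unfolding K_def using ad_nilpotent[OF Rx_neg[OF a] f(1)] by (metis (mono_tags, lifting) LeastI)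
  obtain k where k: "K = Suc k" using K v by (cases K) auto
  define w where "w = (br f ^^ k) v"
  have w: "w \<noteq> 0" "br f w = 0"
    using not_less_Least[of k "\<lambda>n. (br f ^^ n) v = 0"] K k unfolding w_def K_def by auto
  define c where "c = b + cscale (of_nat k) (- a)"
  have wc: "w \<in> G c" unfolding w_def c_def by (rule root_space_br_funpow[OF f(1) v(1)])
  have aD: "a \<in> Dt" and bD: "b \<in> Dt" and cD: "c \<in> Dt" using RxD[OF a] b by (auto simp: c_def)
  have "br (br e f) e = sg 2 e" using f(2)[OF aD e(1)] cartan_self[OF a] by simp
  moreover obtain N where "(br e ^^ N) w = 0" using ad_nilpotent[OF a e(1)] by blast
  ultimately obtain m where m: "cartan ip c a = - of_nat m" "\<forall>j\<le>m. (br e ^^ j) w \<noteq> 0"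
    using lowest_weight[OF w f(2)[OF cD wc]] by blast
  have "cartan ip c a = cartan ip b a - 2 * of_nat k"
    using aD bD RxD(3)[OF a] by (simp add: cartan_def c_def ip_add ip_cscale ip_neg field_simps)
  then have "cartan ip b a = 2 * of_nat k - of_nat m" using m(1) by (simp add: algebra_simps)
  moreover have "b + cscale (of_nat j - of_nat k) a \<in> R" if "j \<le> m" for j
  proof -
    have "b + cscale (of_nat j - of_nat k) a = c + cscale (of_nat j) a"
      by (auto simp: c_def algebra_simps)
    moreover have "c + cscale (of_nat j) a \<in> R"
      using rootI[OF root_space_br_funpow[OF e(1) wc, of j]] m(2) that aD cD by simp
    ultimately show ?thesis by simp
  qed
  ultimately show ?thesis by blast
qed

lemma cartan_integer:
  assumes "a \<in> Rx" "b \<in> R"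
  shows "\<exists>n::int. cartan ip b a = of_int n"
proof -
  obtain k m :: nat where "cartan ip b a = 2 * of_nat k - of_nat m"
    using root_string[OF assms] by blast
  then show ?thesis by (intro exI[of _ "2 * int k - int m"]) simp
qed

text \<open>The reflected root is the member \<open>j = m - k\<close> of the string. Since
  \<open>root_string\<close> does not assert \<open>k \<le> m\<close>, the sign of the Cartan number
  decides whether the string is taken along \<open>a\<close> or along \<open>- a\<close>.\<close>

lemma reflection_root:
  assumes a: "a \<in> Rx" and b: "b \<in> R"
  shows "b - cscale (cartan ip b a) a \<in> R"
proof -
  obtain k m :: nat where km: "cartan ip b a = 2 * of_nat k - of_nat m"
    "\<And>j. j \<le> m \<Longrightarrow> b + cscale (of_nat j - of_nat k) a \<in> R"
    using root_string[OF assms] by blast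
  obtain k' m' :: nat where km': "cartan ip b (- a) = 2 * of_nat k' - of_nat m'"
    "\<And>j. j \<le> m' \<Longrightarrow> b + cscale (of_nat j - of_nat k') (- a) \<in> R"
    using root_string[OF Rx_neg[OF a] b] by blast
  have aD: "a \<in> Dt" and bD: "b \<in> Dt" using RxD[OF a] b by auto
  have neg: "cartan ip b (- a) = - cartan ip b a" using aD bD by (simp add: cartan_def ip_neg)
  show ?thesis
  proof (cases "2 * k \<le> m")
    case True
    then have "b + cscale (of_nat (m - k) - of_nat k) a \<in> R" by (intro km(2)) simp
    moreover have "(of_nat (m - k) :: complex) = of_nat m - of_nat k" using True by (simp add: of_nat_diff)
    then have "of_nat (m - k) - of_nat k = - cartan ip b a" using km(1) by simp
    then have "b - cscale (cartan ip b a) a = b + cscale (of_nat (m - k) - of_nat k) a"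
      by (intro ext) simp
    ultimately show ?thesis by (simp only:)
  next
    case False
    have eq: "(of_int (2 * int k' - int m') :: complex) = of_int (int m - 2 * int k)"
      using km(1) km'(1) neg by simp
    then have "2 * int k' - int m' = int m - 2 * int k" by (simp only: of_int_eq_iff)
    then have "k' \<le> m'" using False by linarith
    then have mem: "b + cscale (of_nat (m' - k') - of_nat k') (- a) \<in> R" by (intro km'(2)) simp
    have "(of_nat (m' - k') :: complex) = of_nat m' - of_nat k'"
      using \<open>k' \<le> m'\<close> by (simp add: of_nat_diff)
    moreover have "cartan ip b a = of_nat m' - 2 * of_nat k'" using km'(1) neg by (simp add: algebra_simps)
    ultimately have "of_nat (m' - k') - of_nat k' = cartan ip b a" by simp
    then have "b - cscale (cartan ip b a) a = b + cscale (of_nat (m' - k') - of_nat k') (- a)"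
      by (intro ext) simp
    then show ?thesis using mem by (simp only:)
  qed
qed

text \<open>Subtracting a multiple of \<open>e\<close> from a vector of \<open>G a\<close> makes it
  orthogonal to \<open>f\<close>, hence killed by \<open>f\<close>. If nonzero, it would be a lowest
  weight vector of weight 2, but \<open>lowest_weight\<close> permits only weights
  \<open>- m\<close>.\<close>

lemma Rx_root_space_dim_one:
  assumes a: "a \<in> Rx" and e: "e \<in> G a" "e \<noteq> 0"
  shows "G a = V.span {e}"
proof
  obtain f where f: "f \<in> G (- a)" "B e f \<noteq> 0"
    "\<And>b v. b \<in> Dt \<Longrightarrow> v \<in> G b \<Longrightarrow> br (br e f) v = sg (cartan ip b a) v"
    using sl2_triple[OF a e] by metis
  have aD: "a \<in> Dt" using RxD[OF a] by simp
  show "G a \<subseteq> V.span {e}"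
  proof
    fix x assume x: "x \<in> G a"
    define y where "y = x - sg (B x f / B e f) e"
    have y: "y \<in> G a" unfolding y_def
      using x e V.subspace_diff[OF root_space_subspace] V.subspace_scale[OF root_space_subspace] by blast
    have "B y f = 0" using f(2) by (simp add: y_def B_diff B_scale)
    then have fy: "br f y = 0" using br_opposite_tvec[OF y f(1) aD] br_anti[of f y] by simp
    have "br (br e f) e = sg 2 e" using f(3)[OF aD e(1)] cartan_self[OF a] by simp
    moreover obtain N where "(br e ^^ N) y = 0" using ad_nilpotent[OF a e(1)] by blast
    moreover have "br (br e f) y = sg 2 y" using f(3)[OF aD y] cartan_self[OF a] by simp
    ultimately have wt: "\<exists>m::nat. (2::complex) = - of_nat m" if "y \<noteq> 0"
      using lowest_weight[OF that fy] by blast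
    have neg: False if "(2::complex) = - of_nat m" for m
    proof -
      have "(of_nat (m + 2) :: complex) = 0" using that by (simp add: eq_neg_iff_add_eq_0 add.commute)
      then show False by (simp only: of_nat_eq_0_iff)
    qed
    have "y = 0" using wt neg by metis
    then have "x = sg (B x f / B e f) e" by (simp add: y_def)
    moreover have "sg c e \<in> V.span {e}" for c by (intro V.span_scale V.span_base) simp
    ultimately show "x \<in> V.span {e}" by metis
  qed
  show "V.span {e} \<subseteq> G a" using e by (intro V.span_minimal root_space_subspace) blast
qed

subsection \<open>Isotropic roots\<close>

text \<open>For isotropic \<open>d\<close> with \<open>(d, b) \<noteq> 0\<close> the algebra spanned by \<open>x\<close>, \<open>y\<close>, \<open>t\<^sub>d\<close> is a
  Heisenberg algebra whose center acts on the \<open>d\<close>-string through \<open>b\<close> by the nonzero scalar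
  \<open>(d, b)\<close>, so the string is infinite.\<close>
lemma isotropic_string_infinite:
  assumes d: "d \<in> R0" and b: "b \<in> R" and nz: "ip b d \<noteq> 0"
  shows "infinite {i::int. b + cscale (of_int i) d \<in> R}"
proof -
  have dD: "d \<in> Dt" and bD: "b \<in> Dt" and dd: "ip d d = 0" using R0D[OF d] b by auto
  obtain x where x: "x \<in> G d" "x \<noteq> 0" using R0D[OF d] root_obtain by blast
  then obtain y where y: "y \<in> G (- d)" "B x y = 1" using root_space_pairing[OF x(1)] dD by auto
  have xy: "br x y = tv d" using br_opposite_tvec[OF x(1) y(1) dD] y(2) by simp
  obtain v where v: "v \<in> G b" "v \<noteq> 0" using b root_obtain by blast
  have unbounded: "infinite I" if unb: "\<And>k::nat. \<exists>i\<in>I. \<bar>i\<bar> \<ge> int k" for I :: "int set"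
  proof
    assume "finite I"
    define M where "M = Max (abs ` I)"
    obtain i where i: "i \<in> I" "\<bar>i\<bar> \<ge> int (nat (M + 1))" using unb by blast
    have "\<bar>i\<bar> \<le> M" unfolding M_def using i(1) \<open>finite I\<close> by simp
    then show False using i(2) by linarith
  qed
  \<comment> \<open>Either the powers of \<open>x\<close> already give an infinite upward string, or
    the last nonzero power yields a vacuum vector \<open>w\<close> from which \<open>y\<close>
    descends forever.\<close>
  show ?thesis
  proof (cases "\<exists>n. (br x ^^ n) v = 0")
    case False
    show ?thesis
    proof (rule unbounded)
      fix k :: nat
      have "b + cscale (of_int (int k)) d \<in> R"
        using rootI[OF root_space_br_funpow[OF x(1) v(1), of k]] False bD dD by simp
      then show "\<exists>i\<in>{i. b + cscale (of_int i) d \<in> R}. \<bar>i\<bar> \<ge> int k"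
        by (intro bexI[of _ "int k"]) auto
    qed
  next
    case True
    define K where "K = (LEAST n. (br x ^^ n) v = 0)"
    have K: "(br x ^^ K) v = 0" unfolding K_def using True by (rule LeastI_ex)
    obtain k where k: "K = Suc k" using K v by (cases K) auto
    define w where "w = (br x ^^ k) v"
    have w: "w \<noteq> 0" "br x w = 0"
      using not_less_Least[of k "\<lambda>n. (br x ^^ n) v = 0"] K k unfolding w_def K_def by auto
    define c where "c = b + cscale (of_nat k) d"
    have cD: "c \<in> Dt" using bD dD by (simp add: c_def)
    have wc: "w \<in> G c" unfolding w_def c_def by (rule root_space_br_funpow[OF x(1) v(1)])
    have wn: "(br y ^^ n) w \<in> G (c + cscale (of_nat n) (- d))" for n
      by (rule root_space_br_funpow[OF y(1) wc])
    have t: "br (br x y) ((br y ^^ n) w) = sg (ip b d) ((br y ^^ n) w)" for n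
    proof -
      have "ip (c + cscale (of_nat n) (- d)) d = ip b d"
        using bD dD dd by (simp add: c_def ip_add ip_cscale ip_neg)
      then show ?thesis using br_tvec[OF wn[of n] _ dD] cD dD xy by simp
    qed
    \<comment> \<open>Because \<open>(d, d) = 0\<close>, the center acts by the same scalar on all
      powers, so moving \<open>x\<close> past one more \<open>y\<close> adds \<open>(b, d)\<close>
      each time. The resulting factor never vanishes.\<close>
    have low: "br x ((br y ^^ Suc n) w) = sg (of_nat (Suc n) * ip b d) ((br y ^^ n) w)" for n
    proof (induct n)
      case 0
      show ?case using br_derivation[of x y w] w(2) t[of 0] by simp
    next
      case (Suc n)
      have "br x (br y ((br y ^^ Suc n) w))
          = br (br x y) ((br y ^^ Suc n) w) + br y (br x ((br y ^^ Suc n) w))"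
        by (rule br_derivation)
      also have "\<dots> = sg (ip b d + of_nat (Suc n) * ip b d) ((br y ^^ Suc n) w)"
        unfolding t Suc br_scale_right V.scale_left_distrib by simp
      also have "ip b d + of_nat (Suc n) * ip b d = of_nat (Suc (Suc n)) * ip b d"
        by (simp add: algebra_simps)
      finally show ?case by (simp only: funpow.simps o_apply)
    qed
    have wnz: "(br y ^^ n) w \<noteq> 0" for n
    proof (induct n)
      case (Suc n)
      have "sg (of_nat (Suc n) * ip b d) ((br y ^^ n) w) \<noteq> 0"
        using Suc nz by (simp only: V.scale_eq_0_iff mult_eq_0_iff of_nat_eq_0_iff) simp
      then show ?case using low[of n] br_zero_right by metis
    qed (use w in simp)
    have mem: "b + cscale (of_int (int k - int n)) d \<in> R" for n
    proof -
      have "b + cscale (of_int (int k - int n)) d = c + cscale (of_nat n) (- d)"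
        by (rule ext) (simp add: c_def algebra_simps)
      then show ?thesis using rootI[OF wn _ wnz, of n] cD dD by simp
    qed
    show ?thesis
    proof (rule unbounded)
      fix j :: nat
      show "\<exists>i\<in>{i. b + cscale (of_int i) d \<in> R}. \<bar>i\<bar> \<ge> int j"
        using mem[of "k + j"] by (intro bexI[of _ "int k - int (k + j)"]) auto
    qed
  qed
qed

text \<open>Otherwise \<open>g + i d\<close> is a root for infinitely many \<open>i\<close>, and integrality of
  \<open>2 (g, g + i d) / (g + i d, g + i d) = 1 + (g, g) / ((g, g) + 2 i (g, d))\<close> fails for large \<open>i\<close>.\<close>
lemma isotropic_orthogonal_Rx:
  assumes d: "d \<in> R0" and g: "g \<in> Rx"
  shows "ip d g = 0"
proof (rule ccontr)
  assume "ip d g \<noteq> 0"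
  then have c: "ip g d \<noteq> 0" by (simp add: ip_sym)
  define q where "q = ip g g"
  define c where "c = ip g d"
  have q0: "q \<noteq> 0" and c0: "c \<noteq> 0" using RxD[OF g] c by (auto simp: q_def c_def)
  have dD: "d \<in> Dt" and gD: "g \<in> Dt" and dd: "ip d d = 0" using R0D[OF d] RxD[OF g] by auto
  have bound: "\<bar>of_int i\<bar> * cmod c \<le> cmod q" if i: "g + cscale (of_int i) d \<in> R" for i :: int
  proof -
    define b where "b = g + cscale (of_int i) d"
    have bD: "b \<in> Dt" using gD dD by (simp add: b_def)
    have bb: "ip b b = q + 2 * of_int i * c"
      using gD dD dd by (simp add: b_def ip_add ip_cscale q_def c_def ip_sym[of d g] algebra_simps)
    have gb: "ip g b = q + of_int i * c"
      using gD dD by (simp add: b_def ip_add ip_cscale q_def c_def)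
    \<comment> \<open>For isotropic \<open>b\<close> the left side is 0. Otherwise \<open>q\<close>
      is the multiple \<open>n - 1\<close> of \<open>2 i c + q\<close>, and
      \<open>n \<noteq> 1\<close> because \<open>q \<noteq> 0\<close>.\<close>
    have main: "cmod (2 * of_int i * c + q) \<le> cmod q"
    proof (cases "ip b b = 0")
      case True
      then show ?thesis using bb by (simp add: add.commute)
    next
      case False
      then have "b \<in> Rx" using RxI i b_def by simp
      then obtain n :: int where "cartan ip g b = of_int n" using cartan_integer RxD[OF g] by blast
      then have "2 * (q + of_int i * c) = of_int n * (q + 2 * of_int i * c)"
        using False bb gb by (simp add: cartan_def field_simps)
      then have "q = of_int (n - 1) * (2 * of_int i * c + q)" by (simp add: algebra_simps)
      then have eq: "cmod q = \<bar>of_int (n - 1)\<bar> * cmod (2 * of_int i * c + q)"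
        by (metis norm_mult norm_of_int)
      then have "n - 1 \<noteq> 0" using q0 by auto
      then have "(1::real) \<le> \<bar>of_int (n - 1)\<bar>" by linarith
      then show ?thesis using eq mult_right_mono[of 1 _ "cmod (2 * of_int i * c + q)"] by fastforce
    qed
    have "cmod (2 * of_int i * c) \<le> cmod (2 * of_int i * c + q) + cmod q"
      by (metis add_diff_cancel_right' norm_triangle_ineq4)
    then have "cmod (2 * of_int i * c) \<le> 2 * cmod q" using main by linarith
    then show ?thesis by (simp add: norm_mult)
  qed
  have "finite {i::int. g + cscale (of_int i) d \<in> R}"
  proof (rule finite_subset)
    show "{i::int. g + cscale (of_int i) d \<in> R} \<subseteq> {- \<lceil>cmod q / cmod c\<rceil>..\<lceil>cmod q / cmod c\<rceil>}"
    proof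
      fix i :: int assume "i \<in> {i. g + cscale (of_int i) d \<in> R}"
      then have "\<bar>of_int i\<bar> \<le> cmod q / cmod c" using bound c0 by (simp add: pos_le_divide_eq)
      then have "of_int \<bar>i\<bar> \<le> cmod q / cmod c" by simp
      then have "\<bar>i\<bar> \<le> \<lceil>cmod q / cmod c\<rceil>" by linarith
      then show "i \<in> {- \<lceil>cmod q / cmod c\<rceil>..\<lceil>cmod q / cmod c\<rceil>}" by auto
    qed
  qed simp
  then show False
    using isotropic_string_infinite[OF d RxD(1)[OF g]] c0 by (simp add: c_def)
qed

section \<open>Orthogonality of the isotropic shifts\<close>

abbreviation T0 where "T0 \<equiv> Rt0 br sg B H"
abbreviation T where "T \<equiv> Rt br sg B H"
abbreviation Lt where "Lt \<equiv> Lambda_t br sg B H"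

lemma T0D:
  assumes "d \<in> T0"
  shows "d \<in> R0" "\<exists>a\<in>Rx. d + a \<in> Rx"
proof -
  show d: "d \<in> R0" using assms by (simp add: Rt0_def)
  obtain a where a: "a \<in> Rx" "d + a \<in> R" using assms by (auto simp: Rt0_def functional_ops)
  have "ip (d + a) (d + a) = ip a a"
    using R0D[OF d] RxD[OF a(1)] isotropic_orthogonal_Rx[OF d a(1)]
    by (simp add: ip_add ip_sym[of a d])
  then have "d + a \<in> Rx" using RxI[OF a(2)] RxD(3)[OF a(1)] by simp
  then show "\<exists>a\<in>Rx. d + a \<in> Rx" using a(1) by blast
qed

lemma T0I: "d \<in> R \<Longrightarrow> ip d d = 0 \<Longrightarrow> a \<in> Rx \<Longrightarrow> d + a \<in> R \<Longrightarrow> d \<in> T0"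
  using R0I by (auto simp: Rt0_def functional_ops)

lemma T_root: "a \<in> T \<Longrightarrow> a \<in> R"
  using T0D R0D RxD by (auto simp: Rt_def)

text \<open>\<open>e = (e + a) - a\<close> is a difference of two nonisotropic roots, each
  orthogonal to \<open>d\<close>.\<close>

lemma isotropic_orthogonal_T0:
  assumes "d \<in> R0" "e \<in> T0" shows "ip d e = 0"
proof -
  obtain a where a: "a \<in> Rx" "e + a \<in> Rx" using T0D[OF assms(2)] by blast
  have "ip d (e + a) = 0" "ip d a = 0" using isotropic_orthogonal_Rx assms(1) a by blast+
  then show ?thesis
    using R0D(2)[OF assms(1)] R0D(2)[OF T0D(1)[OF assms(2)]] RxD(2)[OF a(1)] by (simp add: ip_add)
qed

lemma Lt_subgroup: "additive_subgroup Lt"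
  by (simp add: Lambda_t_def)

lemma Lt_Dt: "l \<in> Lt \<Longrightarrow> l \<in> Dt"
  using zspan_least[OF Dt_subgroup, of T0] R0D(2) T0D(1) unfolding Lambda_t_def by blast

lemma orthogonal_subgroup: "S \<subseteq> Dt \<Longrightarrow> additive_subgroup {l \<in> Dt. \<forall>a\<in>S. ip l a = 0}"
  unfolding additive_subgroup_def by (auto simp: ip_add ip_neg subset_iff)

lemma Lt_orthogonal_Rx: "l \<in> Lt \<Longrightarrow> a \<in> Rx \<Longrightarrow> ip l a = 0"
  using zspan_least[OF orthogonal_subgroup[of Rx], of T0] RxD(2) R0D(2) T0D(1)
    isotropic_orthogonal_Rx unfolding Lambda_t_def by blast

lemma Lt_orthogonal_Lt: assumes "l \<in> Lt" "m \<in> Lt" shows "ip l m = 0"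
proof -
  have "T0 \<subseteq> {l \<in> Dt. \<forall>a\<in>T0. ip l a = 0}"
    using R0D(2) T0D(1) isotropic_orthogonal_T0 by blast
  from zspan_least[OF orthogonal_subgroup this] have 1: "ip l d = 0" if "d \<in> T0" "l \<in> Lt" for d l
    using that R0D(2) T0D(1) unfolding Lambda_t_def by blast
  then have "T0 \<subseteq> {l \<in> Dt. \<forall>a\<in>Lt. ip l a = 0}"
    using R0D(2) T0D(1) ip_sym by fastforce
  from zspan_least[OF orthogonal_subgroup this] show ?thesis
    using assms Lt_Dt unfolding Lambda_t_def by blast
qed

text \<open>For \<open>a \<in> T\<close> this is the whole intersection of the core with \<open>G a\<close>, see
  \<open>core_homogeneous\<close>.\<close>
definition core_part where
  "core_part a = (if a \<in> Rx then G a else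
     V.span {br x y | x y b c. b \<in> Rx \<and> c \<in> Rx \<and> b + c = a \<and> x \<in> G b \<and> y \<in> G c})"

lemma core_part_subspace: "V.subspace (core_part a)"
  by (simp add: core_part_def root_space_subspace)

lemma core_part_root_space: "core_part a \<subseteq> G a"
proof (cases "a \<in> Rx")
  case False
  have "{br x y | x y b c. b \<in> Rx \<and> c \<in> Rx \<and> b + c = a \<and> x \<in> G b \<and> y \<in> G c} \<subseteq> G a"
    using root_space_br by blast
  then show ?thesis
    using V.span_minimal[OF _ root_space_subspace] False by (simp add: core_part_def)
qed (simp add: core_part_def)

section \<open>The core and its homogeneous components\<close>

abbreviation C where "C \<equiv> core sg br B H"

lemma core_subspace: "V.subspace C"
  unfolding V.subspace_def core_def by (blast intro: gen_subalg.intros)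

lemma core_br: "x \<in> C \<Longrightarrow> y \<in> C \<Longrightarrow> br x y \<in> C"
  unfolding core_def by (rule gen_subalg.brk)

lemma core_base: "a \<in> Rx \<Longrightarrow> x \<in> G a \<Longrightarrow> x \<in> C"
  unfolding core_def by (blast intro: gen_subalg.base)

lemma core_part_core: "core_part a \<subseteq> C"
proof (cases "a \<in> Rx")
  case False
  have "{br x y | x y b c. b \<in> Rx \<and> c \<in> Rx \<and> b + c = a \<and> x \<in> G b \<and> y \<in> G c} \<subseteq> C"
    using core_base core_br by blast
  then show ?thesis
    using V.span_minimal[OF _ core_subspace] False by (simp add: core_part_def)
qed (use core_base in \<open>auto simp: core_part_def\<close>)

lemma span_br:
  assumes "x \<in> V.span S" "y \<in> V.span S'" "V.subspace W" "\<And>x y. x \<in> S \<Longrightarrow> y \<in> S' \<Longrightarrow> br x y \<in> W"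
  shows "br x y \<in> W"
proof -
  have 1: "br x y \<in> W" if "x \<in> S" for x
    using assms(2)
    by (induct rule: V.span_induct_alt)
      (use that assms(3,4) V.subspace_0 V.subspace_add V.subspace_scale in \<open>auto simp: br_add_right br_scale_right\<close>)
  show ?thesis using assms(1)
    by (induct rule: V.span_induct_alt)
      (use 1 assms(3) V.subspace_0 V.subspace_add V.subspace_scale in \<open>auto simp: br_add_left br_scale_left\<close>)
qed

lemma br_Rx_Rx:
  assumes "a \<in> Rx" "b \<in> Rx" "x \<in> G a" "y \<in> G b"
  shows "br x y = 0 \<or> (a + b \<in> T \<and> br x y \<in> core_part (a + b))"
proof (cases "br x y = 0")
  case False
  have D: "a \<in> Dt" "b \<in> Dt" using RxD assms by auto
  have R: "a + b \<in> R" using rootI[OF root_space_br[OF assms(3,4)]] False D by simp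
  show ?thesis
  proof (cases "a + b \<in> Rx")
    case True
    then show ?thesis using root_space_br[OF assms(3,4)] by (simp add: core_part_def Rt_def)
  next
    case False
    then have "ip (a + b) (a + b) = 0" using R RxI by blast
    \<comment> \<open>The witness for \<open>R_t^0\<close> is \<open>- a\<close>: adding it to the
      isotropic sum returns the root \<open>b\<close>.\<close>
    then have "a + b \<in> T0" using T0I[OF R _ Rx_neg[OF assms(1)]] RxD[OF assms(2)] by simp
    moreover have "br x y \<in> core_part (a + b)"
      unfolding core_part_def using False assms by (auto intro!: V.span_base)
    ultimately show ?thesis by (simp add: Rt_def)
  qed
qed simp

lemma br_isotropic_Rx:
  assumes "d \<in> T0" "b \<in> Rx" "x \<in> G d" "y \<in> G b"
  shows "br x y = 0 \<or> (d + b \<in> Rx \<and> br x y \<in> G (d + b))"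
proof (cases "br x y = 0")
  case False
  have D: "d \<in> Dt" "b \<in> Dt" "ip d d = 0" "ip d b = 0"
    using RxD R0D T0D(1) assms isotropic_orthogonal_Rx by blast+
  have R: "d + b \<in> R" using rootI[OF root_space_br[OF assms(3,4)]] False D by simp
  have "ip (d + b) (d + b) = ip b b" using D by (simp add: ip_add ip_sym[of b d])
  then show ?thesis using RxI[OF R] RxD[OF assms(2)] root_space_br[OF assms(3,4)] by simp
qed simp

definition core_generators where
  "core_generators = (\<Union>a\<in>Rx. G a) \<union>
     {br x y | x y a b. a \<in> Rx \<and> b \<in> Rx \<and> a + b \<in> T0 \<and> x \<in> G a \<and> y \<in> G b}"

text \<open>This is why one round of brackets suffices. A bracket of an isotropic with a
  nonisotropic degree lands in a nonisotropic root space or vanishes. If \<open>x = br u v\<close>,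
  the Jacobi identity turns \<open>br x y\<close> into iterated brackets with \<open>u\<close> and
  \<open>v\<close>, which have nonisotropic degree.\<close>

lemma core_generators_br:
  assumes "x \<in> core_generators" "y \<in> core_generators"
  shows "br x y \<in> V.span core_generators"
proof -
  let ?S = "V.span core_generators"
  have zero: "0 \<in> ?S" by (rule V.span_zero)
  have G: "x \<in> ?S" if "a \<in> Rx" "x \<in> G a" for a x
    using that by (intro V.span_base) (auto simp: core_generators_def)
  have RR: "br x y \<in> ?S" if xy: "a \<in> Rx" "b \<in> Rx" "x \<in> G a" "y \<in> G b" for a b x y
  proof (cases "a + b \<in> T0")
    case True
    then show ?thesis using xy by (intro V.span_base) (auto simp: core_generators_def)
  next
    case False
    then have "br x y = 0 \<or> a + b \<in> Rx" using br_Rx_Rx[OF xy] by (auto simp: Rt_def)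
    then show ?thesis using G root_space_br[OF xy(3,4)] zero by auto
  qed
  have TR: "br x y = 0 \<or> (\<exists>c\<in>Rx. br x y \<in> G c)" if "d \<in> T0" "b \<in> Rx" "x \<in> G d" "y \<in> G b" for d b x y
    using br_isotropic_Rx[OF that] by blast
  have TR': "br x y = 0 \<or> (\<exists>c\<in>Rx. br x y \<in> G c)" if "d \<in> T0" "b \<in> Rx" "x \<in> G b" "y \<in> G d" for d b x y
    using TR[OF that(1,2,4,3)] br_anti[of x y] V.subspace_neg[OF root_space_subspace] by auto
  have RM: "br x y \<in> ?S" if x: "a \<in> Rx" "x \<in> G a" and y: "y \<in> core_generators" for a x y
  proof -
    consider b where "b \<in> Rx" "y \<in> G b" | d where "d \<in> T0" "y \<in> G d"
      using y root_space_br unfolding core_generators_def by blast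
    then show ?thesis
    proof cases
      case 1
      then show ?thesis using RR x by blast
    next
      case 2
      show ?thesis using TR'[OF 2(1) x 2(2)] G zero by auto
    qed
  qed
  consider a where "a \<in> Rx" "x \<in> G a"
    | u v a b where "x = br u v" "a \<in> Rx" "b \<in> Rx" "u \<in> G a" "v \<in> G b"
    using assms(1) unfolding core_generators_def by blast
  then show ?thesis
  proof cases
    case 1
    then show ?thesis using RM assms(2) by blast
  next
    case 2
    have RS: "br w z \<in> ?S" if "c \<in> Rx" "w \<in> G c" "z \<in> ?S" for c w z
      using that RM[OF that(1,2)]
      by (intro span_br[of w "{w}" z core_generators ?S]) (auto intro: V.span_base)
    have "br u (br v y) \<in> ?S" "br v (br u y) \<in> ?S"
      using 2 RS RM assms(2) by blast+
    then
    show ?thesis using 2 V.span_diff by (simp add: br_derivation_left)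
  qed
qed

lemma core_eq_span: "C = V.span core_generators"
proof
  show "C \<subseteq> V.span core_generators"
  proof
    fix x assume "x \<in> C"
    then show "x \<in> V.span core_generators" unfolding core_def
    proof induct
      case (base x)
      then show ?case by (intro V.span_base) (auto simp: core_generators_def)
    next
      case (brk x y)
      then show ?case using span_br[OF brk(2,4) V.subspace_span] core_generators_br by blast
    qed (auto intro: V.span_zero V.span_add V.span_scale)
  qed
  show "V.span core_generators \<subseteq> C"
    using core_base core_br
    by (intro V.span_minimal core_subspace) (unfold core_generators_def, blast)
qed

lemma core_decomposition:
  assumes "x \<in> C"
  obtains F v where "finite F" "F \<subseteq> T" "\<And>a. a \<in> F \<Longrightarrow> v a \<in> core_part a" "x = (\<Sum>a\<in>F. v a)"
proof -
  have "core_generators \<subseteq> V.span (\<Union>a\<in>T. core_part a)"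
  proof
    fix x assume "x \<in> core_generators"
    then consider a where "a \<in> Rx" "x \<in> G a"
      | u v a b where "x = br u v" "a \<in> Rx" "b \<in> Rx" "u \<in> G a" "v \<in> G b"
      unfolding core_generators_def by blast
    then show "x \<in> V.span (\<Union>a\<in>T. core_part a)"
    proof cases
      case 1
      then show ?thesis by (intro V.span_base) (auto simp: Rt_def core_part_def)
    next
      case 2
      from br_Rx_Rx[OF 2(2-5)] show ?thesis
        by (auto simp: 2(1) V.span_zero intro: V.span_base)
    qed
  qed
  then have "V.span core_generators \<subseteq> V.span (\<Union>a\<in>T. core_part a)"
    by (intro V.span_minimal) auto
  then have "x \<in> V.span (\<Union>a\<in>T. core_part a)" using assms core_eq_span by blast
  from V.span_UN_subspaces[OF core_part_subspace this] show ?thesis using that by blast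
qed

lemma core_homogeneous:
  assumes x: "x \<in> C" "x \<in> G a" "a \<in> D" "x \<noteq> 0"
  shows "a \<in> T" "x \<in> core_part a"
proof -
  obtain F v where F: "finite F" "F \<subseteq> T" "\<And>a. a \<in> F \<Longrightarrow> v a \<in> core_part a" "x = (\<Sum>a\<in>F. v a)"
    using core_decomposition[OF x(1)] by blast
  \<comment> \<open>The difference of two decompositions of \<open>x\<close>, taken over
    \<open>insert a F\<close> so as to cover \<open>a \<notin> F\<close>; its vanishing at
    \<open>a\<close> excludes that case.\<close>
  define u where "u i = (if i \<in> F then v i else 0) - (if i = a then x else 0)" for i
  have "(\<Sum>i\<in>insert a F. if i \<in> F then v i else 0) = x"
    unfolding F(4) using F(1) by (intro sum.mono_neutral_cong_right) auto
  then have "(\<Sum>i\<in>insert a F. u i) = 0"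
    using F(1) by (simp add: u_def sum_subtractf sum.delta del: sum.insert)
  moreover have "u i \<in> G (id i)" if "i \<in> insert a F" for i
    using that F(3) core_part_root_space x(2) V.subspace_0[OF root_space_subspace]
      V.subspace_neg[OF root_space_subspace]
    by (auto simp: u_def intro!: V.subspace_diff[OF root_space_subspace])
  ultimately have "u a = 0"
    using F T_root x(3) by (intro root_spaces_independent[of "insert a F" id u]) auto
  then have "a \<in> F \<and> v a = x" using x(4) by (auto simp: u_def split: if_splits)
  then show "a \<in> T" "x \<in> core_part a" using F(2,3) by blast+
qed

section \<open>The center of the core\<close>

abbreviation Z where "Z \<equiv> center_of br C"

text \<open>For \<open>y\<close> of degree \<open>b\<close> in the core, the brackets
  \<open>br (v i) y\<close> have distinct degrees \<open>\<phi> i + b\<close> and sum to zero, so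
  each vanishes; such \<open>y\<close> span the core.\<close>

lemma center_homogeneous:
  assumes F: "finite F" "inj_on \<phi> F" "\<And>i. i \<in> F \<Longrightarrow> \<phi> i \<in> D"
    and v: "\<And>i. i \<in> F \<Longrightarrow> v i \<in> C \<inter> G (\<phi> i)" and s: "(\<Sum>i\<in>F. v i) \<in> Z" and i: "i \<in> F"
  shows "v i \<in> Z"
proof -
  have hom: "br (v i) y = 0" if y: "y \<in> C" "y \<in> G b" "b \<in> D" for y b
  proof (rule root_spaces_independent[of F "\<lambda>i. \<phi> i + b" "\<lambda>i. br (v i) y"])
    show "(\<Sum>i\<in>F. br (v i) y) = 0"
      using s y unfolding center_of_def by (simp add: br_sum_left)
  qed (use F v i y root_space_br in \<open>auto simp: inj_on_def\<close>)
  have "br (v i) y = 0" if y: "y \<in> C" for y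
  proof -
    obtain E w where E: "finite E" "E \<subseteq> T" "\<And>a. a \<in> E \<Longrightarrow> w a \<in> core_part a" "y = (\<Sum>a\<in>E. w a)"
      using core_decomposition[OF y] by blast
    have "br (v i) (w a) = 0" if "a \<in> E" for a
      using hom[of "w a" a] E that core_part_core core_part_root_space T_root R_dual by blast
    then show ?thesis unfolding E(4) br_sum_right by simp
  qed
  then show ?thesis using v i unfolding center_of_def by blast
qed

text \<open>The \<open>sl_2\<close>-partner \<open>f\<close> of a nonzero \<open>x\<close> lies in
  the core, and \<open>br x f\<close> acts on \<open>x\<close> by 2. Nonisotropic root spaces
  therefore survive in the quotient.\<close>

lemma center_root_space:
  assumes a: "a \<in> Rx" and x: "x \<in> G a" "x \<in> Z"
  shows "x = 0"
proof (rule ccontr)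
  assume x0: "x \<noteq> 0"
  obtain f where f: "f \<in> G (- a)"
    "\<And>b v. b \<in> Dt \<Longrightarrow> v \<in> G b \<Longrightarrow> br (br x f) v = sg (cartan ip b a) v"
    using sl2_triple[OF a x(1) x0] by metis
  have "f \<in> C" using core_base[OF Rx_neg[OF a] f(1)] .
  then have "br x f = 0" using x(2) unfolding center_of_def by blast
  then have "sg 2 x = 0" using f(2)[of a x] x(1) RxD[OF a] cartan_self[OF a] by simp
  then show False using x0 by simp
qed

section \<open>Finite generation of the isotropic shifts\<close>

lemma Re_Im_mult: "of_real (Re z) * u + of_real (Im z) * (\<i> * u) = z * u"
  by (simp add: complex_eq_iff)

text \<open>The coordinate functionals of a basis of \<open>H\<close> and their multiples by
  \<open>\<i>\<close> span over the reals. This is the ambient space for the lattice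
  argument.\<close>

lemma dual_finite_real_dimension: "\<exists>E. finite E \<and> D \<subseteq> real_functions.span E"
proof -
  obtain S where S: "finite S" "H = V.span S" using H_finite_dim by blast
  obtain S' where S': "S' \<subseteq> S" "V.independent S'" "S \<subseteq> V.span S'"
    using V.maximal_independent_subset[of S] by blast
  have fin: "finite S'" using S S' finite_subset by blast
  have HS: "H = V.span S'"
    using S(2) V.span_mono[OF S'(1)] V.span_minimal[OF S'(3) V.subspace_span] by blast
  define \<phi> where "\<phi> s = (\<lambda>x. if x \<in> H then V.representation S' x s else 0)" for s
  define E where "E = \<phi> ` S' \<union> (\<lambda>s. cscale \<i> (\<phi> s)) ` S'"
  have "a \<in> real_functions.span E" if a: "a \<in> D" for a
  proof -
    have expand: "a x = (\<Sum>s\<in>S'. a s * \<phi> s x)" for x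
    proof (cases "x \<in> H")
      case True
      have lin: "a (\<Sum>s\<in>U. sg (r s) s) = (\<Sum>s\<in>U. r s * a s)" if "finite U" "U \<subseteq> H" for U r
        using that
      proof (induct U rule: finite_induct)
        case empty
        show ?case using dual_comb[OF a, of 0 0 1] V.subspace_0[OF H_subspace] by simp
      next
        case (insert s U)
        have "(\<Sum>s\<in>U. sg (r s) s) \<in> H"
          using insert.prems by (intro V.subspace_sum[OF H_subspace] V.subspace_scale[OF H_subspace]) auto
        moreover have "s \<in> H" using insert.prems by blast
        ultimately show ?case
          using dual_comb[OF a, of s _ "r s"] insert.hyps insert.prems by simp
      qed
      have "x = (\<Sum>s\<in>S'. sg (V.representation S' x s) s)"
        using V.sum_representation_eq[OF S'(2) _ fin order_refl, of x] True HS by simp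
      then have "a x = (\<Sum>s\<in>S'. V.representation S' x s * a s)"
        using lin[OF fin, of "V.representation S' x"] HS V.span_superset by metis
      then show ?thesis using True by (simp add: \<phi>_def mult.commute)
    qed (use dual_outside[OF a] in \<open>simp add: \<phi>_def\<close>)
    have parts: "a s * \<phi> s x = (rscale (Re (a s)) (\<phi> s) + rscale (Im (a s)) (cscale \<i> (\<phi> s))) x" for s x
      using Re_Im_mult[of "a s" "\<phi> s x"] by (simp add: rscale_def)
    have "a = (\<Sum>s\<in>S'. rscale (Re (a s)) (\<phi> s) + rscale (Im (a s)) (cscale \<i> (\<phi> s)))"
      by (rule ext) (unfold sum_fun_apply parts[symmetric], rule expand)
    also have "\<dots> \<in> real_functions.span E"
      by (intro real_functions.span_sum real_functions.span_add real_functions.span_scale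
          real_functions.span_base) (auto simp: E_def)
    finally show ?thesis .
  qed
  then show ?thesis using fin by (intro exI[of _ E]) (auto simp: E_def)
qed

text \<open>Composing the reflections in \<open>a\<close> and in \<open>a + m\<close> gives \<open>S + 2 S \<subseteq> S\<close> for the set \<open>S\<close> of
  isotropic shifts of \<open>a\<close>, hence \<open>a + 2 l \<in> R\<close> for every \<open>l\<close> in the group generated by \<open>S\<close>, and
  discreteness passes from \<open>R\<close> to that group.\<close>
lemma isotropic_shifts_finitely_generated:
  assumes a: "a \<in> Rx"
  shows "\<exists>U. finite U \<and> zspan U = zspan {l \<in> Lt. a + l \<in> R}"
proof -
  define S where "S = {l \<in> Lt. a + l \<in> R}"
  have aD: "a \<in> Dt" using RxD[OF a] by simp
  have S0: "0 \<in> S" using RxD[OF a] additive_subgroupD[OF Lt_subgroup] by (simp add: S_def)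
  \<comment> \<open>Shifts do not change the form, so the Cartan number of \<open>a + l\<close> with
    respect to \<open>a + m\<close> is 2, and the negative of the reflected root is
    \<open>a + (2 m - l)\<close>.\<close>
  have refl: "m + m - l \<in> S" if "l \<in> S" "m \<in> S" for l m
  proof -
    have lm: "l \<in> Lt" "m \<in> Lt" "l \<in> Dt" "m \<in> Dt" "a + l \<in> R" "a + m \<in> R"
      using that Lt_Dt by (auto simp: S_def)
    have ip: "ip (a + l) (a + m) = ip a a" "ip (a + m) (a + m) = ip a a"
      using lm(1-4) aD Lt_orthogonal_Rx[OF lm(1) a] Lt_orthogonal_Rx[OF lm(2) a] Lt_orthogonal_Lt[OF lm(1,2)]
        Lt_orthogonal_Lt[OF lm(2,2)]
      by (simp_all add: ip_add ip_sym[of a l] ip_sym[of a m])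
    then have "a + m \<in> Rx" using lm RxD[OF a] RxI by simp
    moreover have "cartan ip (a + l) (a + m) = 2" using ip RxD[OF a] by (simp add: cartan_def)
    ultimately have "(a + l) - cscale 2 (a + m) \<in> R" using reflection_root lm(5) by metis
    then have "- ((a + l) - cscale 2 (a + m)) \<in> R" by (rule R_neg)
    moreover have "- ((a + l) - cscale 2 (a + m)) = a + (m + m - l)"
      by (rule ext) (simp add: algebra_simps)
    moreover have "m + m - l \<in> Lt" using lm additive_subgroupD[OF Lt_subgroup] by blast
    ultimately show ?thesis by (simp only: S_def mem_Collect_eq simp_thms)
  qed
  have neg: "- l \<in> S" if "l \<in> S" for l using refl[OF that S0] by simp
  have shift: "s + (m + m) \<in> S" if "s \<in> S" "m \<in> S" for s m
    using refl[OF neg[OF that(1)] that(2)] by (simp add: add.commute)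
  define dbl where "dbl l = l + l" for l :: "'g functional"
  have dbl: "dbl 0 = 0" "dbl (l + m) = dbl l + dbl m" "dbl (- l) = - dbl l" for l m
    by (simp_all add: dbl_def algebra_simps)
  \<comment> \<open>\<open>S\<close> need not be a group, but the \<open>l\<close> for which
    translation by \<open>2 l\<close> and by \<open>- 2 l\<close> preserves \<open>S\<close> form
    one.\<close>
  define P where "P = {l. \<forall>s\<in>S. s + dbl l \<in> S \<and> s - dbl l \<in> S}"
  have "additive_subgroup P"
    unfolding additive_subgroup_def
  proof (intro conjI ballI)
    fix l m assume "l \<in> P" "m \<in> P"
    then show "l + m \<in> P"
      unfolding P_def dbl mem_Collect_eq by (simp only: add.assoc[symmetric] diff_diff_eq[symmetric]) blast
  qed (auto simp: P_def dbl)
  moreover have "S \<subseteq> P"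
  proof
    fix l assume l: "l \<in> S"
    have "s + dbl l \<in> S \<and> s + dbl (- l) \<in> S" if "s \<in> S" for s
      using shift[OF that l] shift[OF that neg[OF l]] by (simp only: dbl_def simp_thms)
    then show "l \<in> P" by (simp add: P_def dbl)
  qed
  ultimately have "zspan S \<subseteq> P" by (rule zspan_least)
  then have double: "l + l \<in> S" if "l \<in> zspan S" for l
    using that S0 unfolding P_def dbl_def by (metis (no_types, lifting) add_0 mem_Collect_eq subsetD)
  obtain F e where F: "finite F" "e > (0::real)"
    "\<And>b. b \<in> R \<Longrightarrow> (\<forall>h\<in>F. cmod (b h - a h) < e) \<Longrightarrow> b = a"
    using R_discrete[OF RxD(1)[OF a]] by blast
  obtain E where E: "finite E" "D \<subseteq> real_functions.span E" using dual_finite_real_dimension by blast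
  have "S \<subseteq> Lt" by (auto simp: S_def)
  then have "zspan S \<subseteq> D" using zspan_least[OF Lt_subgroup] Lt_Dt Dt_dual by blast
  have "\<exists>U. finite U \<and> zspan U = zspan S"
  proof (rule discrete_subgroup_finitely_generated)
    show "zspan S \<subseteq> real_functions.span E" using \<open>zspan S \<subseteq> D\<close> E by blast
    \<comment> \<open>Half of \<open>e\<close>, because discreteness of \<open>R\<close> at
      \<open>a\<close> is applied to \<open>a + 2 l\<close>.\<close>
    fix l assume l: "l \<in> zspan S" "\<forall>h\<in>F. cmod (l h) < e / 2"
    have "a + (l + l) \<in> R" using double[OF l(1)] by (simp add: S_def)
    moreover have "cmod ((a + (l + l)) h - a h) < e" if "h \<in> F" for h
      using l(2) that norm_triangle_ineq[of "l h" "l h"] by fastforce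
    ultimately have "a + (l + l) = a" using F(3) by blast
    then have "l + l = 0" by simp
    then have "2 * l h = 0" for h unfolding mult_2 by (metis plus_fun_apply zero_fun_apply)
    then have "l h = 0" for h by simp
    then show "l = 0" by (intro ext) simp
  qed (use E F in auto)
  then show ?thesis by (simp add: S_def)
qed

end

section \<open>The core modulo its center\<close>

locale core_quotient = generalized_reductive sg br B H
  for sg :: "complex \<Rightarrow> 'g::ab_group_add \<Rightarrow> 'g" and br B H +
  fixes Rd :: "'g functional set"
    and sl :: "complex \<Rightarrow> 'l::ab_group_add \<Rightarrow> 'l"
    and brL :: "'l \<Rightarrow> 'l \<Rightarrow> 'l"
    and p :: "'g \<Rightarrow> 'l"
  assumes Rd_dual: "Rd \<subseteq> D"
    and Rd_rs: "irreducible_finite_root_system ip Rd"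
    and Rt_sub: "T \<subseteq> {fplus a l | a l. a \<in> Rd \<and> l \<in> Lt}"
    and Rd_ind: "indivisible Rd \<subseteq> Rx \<union> {fzero}"
    and span_R: "zspan R = {fplus a l | a l. a \<in> zspan Rd \<and> l \<in> Lambda br sg B H}"
    and direct: "zspan Rd \<inter> Lambda br sg B H = {fzero}"
    and quot: "is_quotient_map sg br sl brL p C Z"
begin

section \<open>The finite root system and the degrees \<open>a + l\<close>\<close>

lemma zspan_Rd_dual: "a \<in> zspan Rd \<Longrightarrow> a \<in> D"
  using zspan_least[OF dual_subgroup Rd_dual] by blast

text \<open>An element of \<open>Rd\<close> need not be a root, but the decomposition of
  \<open>zspan R\<close> makes it an integral combination of roots.\<close>

lemma Rd_Dt: assumes "a \<in> Rd" shows "a \<in> Dt"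
proof -
  have "a + 0 \<in> zspan R"
    unfolding span_R functional_ops Lambda_def using assms zspan_base zspan_zero by blast
  moreover have "zspan R \<subseteq> Dt" by (intro zspan_least Dt_subgroup) auto
  ultimately show ?thesis by auto
qed

lemma Lt_Lambda: "Lt \<subseteq> Lambda br sg B H"
  unfolding Lambda_def Lambda_t_def zspan_subset_iff using T0D(1) zspan_base by blast

text \<open>\<open>\<Lambda>_t\<close> lies in \<open>\<Lambda>\<close>, which meets
  \<open>zspan Rd\<close> only in 0. So a functional determines its degree
  \<open>(a, l)\<close>.\<close>

lemma degree_unique:
  assumes "a \<in> zspan Rd" "b \<in> zspan Rd" "l \<in> Lt" "m \<in> Lt" "a + l = b + m"
  shows "a = b" "l = m"
proof -
  have "a - b = m - l" using assms(5) by (simp add: algebra_simps)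
  moreover have "a - b \<in> zspan Rd" using assms zspan_diff by blast
  moreover have "m - l \<in> Lambda br sg B H"
    using assms Lt_Lambda additive_subgroupD(4)[OF Lt_subgroup] by blast
  ultimately have "a - b \<in> zspan Rd \<inter> Lambda br sg B H" by simp
  then have "a - b = 0" unfolding direct functional_ops by simp
  with \<open>a - b = m - l\<close> have "a - b = 0" "m - l = 0" by (simp_all only:)
  then show "a = b" "l = m" by simp_all
qed

lemma zero_Rd: "0 \<in> Rd"
  using Rd_rs by (simp add: irreducible_finite_root_system_def functional_ops)

lemma finite_Rd: "finite Rd"
  using Rd_rs by (simp add: irreducible_finite_root_system_def)

lemma Rd_cartan: "a \<in> Rd \<Longrightarrow> a \<noteq> 0 \<Longrightarrow> b \<in> Rd \<Longrightarrow> cartan ip b a \<in> \<int>"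
  using Rd_rs by (simp add: irreducible_finite_root_system_def functional_ops)

lemma Rd_nonisotropic: assumes "a \<in> Rd" "a \<noteq> 0" shows "ip a a \<noteq> 0"
proof -
  have "a \<in> rspan Rd"
    unfolding rspan_def using assms by (intro CollectI exI[of _ "{a}"] exI[of _ "\<lambda>_. 1"]) auto
  then show ?thesis
    using Rd_rs assms(2) unfolding irreducible_finite_root_system_def functional_ops by fastforce
qed

lemma indivisible_cases:
  assumes "a \<in> Rd" "a \<noteq> 0"
  shows "a \<in> indivisible Rd \<or> cscale (1/2) a \<in> indivisible Rd"
proof (cases "cscale (1/2) a \<in> Rd")
  case True
  \<comment> \<open>\<open>a / 4\<close> would have Cartan number \<open>1 / 2\<close> with respect
    to \<open>a\<close>, so halving is possible at most once.\<close>
  have "cscale (1/4) a \<notin> Rd"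
  proof
    assume "cscale (1/4) a \<in> Rd"
    then have "cartan ip (cscale (1/4) a) a \<in> \<int>" using Rd_cartan assms by blast
    moreover have "cartan ip (cscale (1/4) a) a = of_real (1 / 2)"
      using Rd_nonisotropic[OF assms] Rd_Dt[OF assms(1)] by (simp add: cartan_def ip_cscale)
    ultimately have "(1 / 2 :: real) \<in> \<int>" by (metis of_real_in_Ints_iff)
    then obtain n where "(1 / 2 :: real) = of_int n" by (auto elim: Ints_cases)
    then have "(1::real) = of_int (2 * n)" by simp
    then have "1 = 2 * n" by (metis of_int_1 of_int_eq_iff)
    then show False by presburger
  qed
  moreover have "(\<lambda>h. cscale (1/2) a h / 2) = cscale (1/4) a" by (rule ext) simp
  ultimately show ?thesis using True by (simp add: indivisible_def)
next
  case False
  moreover have "(\<lambda>h. a h / 2) = cscale (1/2) a" by (rule ext) simp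
  ultimately show ?thesis using assms by (simp add: indivisible_def)
qed

lemma indivisible_Rx: "a \<in> indivisible Rd \<Longrightarrow> a \<in> Rx"
  using Rd_ind zero_Rd by (auto simp: indivisible_def functional_ops zero_fun_def)

text \<open>A divisible element is twice an indivisible one, which is a nonisotropic root;
  orthogonality holds there and is scaled.\<close>

lemma Lt_orthogonal_Rd:
  assumes l: "l \<in> Lt" and a: "a \<in> Rd" shows "ip l a = 0" "ip a l = 0"
proof -
  have "ip l a = 0"
  proof (cases "a = 0")
    case False
    show ?thesis
    proof (cases "a \<in> indivisible Rd")
      case True
      then show ?thesis using Lt_orthogonal_Rx[OF l indivisible_Rx] by simp
    next
      case 2: False
      then have "cscale (1/2) a \<in> Rx" using indivisible_cases[OF a False] indivisible_Rx by blast
      from Lt_orthogonal_Rx[OF l this] show ?thesis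
        using Lt_Dt[OF l] Rd_Dt[OF a] by (simp add: ip_cscale)
    qed
  qed (use Lt_Dt[OF l] in simp)
  then show "ip l a = 0" "ip a l = 0" by (simp_all add: ip_sym)
qed

text \<open>Cartan numbers of shifted roots thus depend on the finite parts alone, as the coroot
  axiom of a Lie torus demands.\<close>

lemma ip_degree:
  assumes "a \<in> Rd" "b \<in> Rd" "l \<in> Lt" "m \<in> Lt"
  shows "ip (b + m) (a + l) = ip b a"
  using assms Rd_Dt Lt_Dt by (simp add: ip_add Lt_orthogonal_Rd Lt_orthogonal_Lt)

lemma shifted_root_Rx:
  assumes "a \<in> Rd" "a \<noteq> 0" "l \<in> Lt" "a + l \<in> R" shows "a + l \<in> Rx"
  using RxI[OF assms(4)] ip_degree[of a a l l] Rd_nonisotropic assms by simp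

lemma T_degree: "b \<in> T \<Longrightarrow> \<exists>a\<in>Rd. \<exists>l\<in>Lt. b = a + l"
  using Rt_sub unfolding functional_ops by blast

lemma Rx_degree: assumes "b \<in> Rx" shows "\<exists>a\<in>Rd - {0}. \<exists>l\<in>Lt. b = a + l"
proof -
  obtain a l where al: "a \<in> Rd" "l \<in> Lt" "b = a + l" using T_degree[of b] assms unfolding Rt_def by blast
  then have "a \<noteq> 0" using RxD(3)[OF assms] Lt_orthogonal_Lt by auto
  then show ?thesis using al by blast
qed

text \<open>Exhibits \<open>d\<close> as the difference of two shifts \<open>l + d\<close> and
  \<open>l\<close> of one \<open>a\<close>. Generation of \<open>\<Lambda>_t\<close> by shifts, for
  freeness and for the support axiom, rests on this.\<close>

lemma T0_degrees: assumes "d \<in> T0" shows "\<exists>a\<in>Rd - {0}. \<exists>l\<in>Lt. a + l \<in> Rx \<and> a + (l + d) \<in> Rx"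
proof -
  obtain b where b: "b \<in> Rx" "d + b \<in> Rx" using T0D[OF assms] by blast
  obtain a l where "a \<in> Rd - {0}" "l \<in> Lt" "b = a + l" using Rx_degree[OF b(1)] by blast
  then show ?thesis using b by (intro bexI[of _ a] bexI[of _ l]) (auto simp: add_ac)
qed

lemma T0_Lt: "d \<in> T0 \<Longrightarrow> d \<in> Lt"
  unfolding Lambda_t_def by (rule zspan_base)

lemma Lt_free: "free_abelian_finite_rank Lt"
proof -
  define S where "S a = {l \<in> Lt. a + l \<in> R}" for a
  have fin: "finite (indivisible Rd)" using finite_Rd by (auto simp: indivisible_def)
  have "\<exists>U. finite U \<and> zspan U = zspan (S a)" if "a \<in> indivisible Rd" for a
    using isotropic_shifts_finitely_generated[OF indivisible_Rx[OF that]] by (simp add: S_def)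
  from zspan_UN_finitely_generated[where S = S, OF fin this]
  obtain U where U: "finite U" "zspan U = zspan (\<Union>a\<in>indivisible Rd. S a)" by blast
  let ?U = "\<Union>a\<in>indivisible Rd. S a"
  have gen: "l \<in> zspan ?U" if l: "l \<in> Lt" and a: "a \<in> Rd - {0}" "a + l \<in> Rx" for a l
  proof (cases "a \<in> indivisible Rd")
    case True
    then show ?thesis using l RxD[OF a(2)] by (intro zspan_base) (auto simp: S_def)
  next
    case False
    \<comment> \<open>For divisible \<open>a\<close> the shift is moved to \<open>b = a / 2\<close>:
      the Cartan number of \<open>b\<close> with respect to \<open>a + l\<close> is 1, so minus the
      reflection of \<open>b\<close> is \<open>b + l\<close>, and \<open>l\<close> is a shift of the
      indivisible \<open>b\<close>.\<close>
    define b where "b = cscale (1/2) a"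
    have b: "b \<in> indivisible Rd" using indivisible_cases False a by (auto simp: b_def)
    then have "b \<in> Rd" by (simp add: indivisible_def)
    have aD: "a \<in> Dt" and lD: "l \<in> Dt" and aR: "a \<in> Rd" using a Rd_Dt l Lt_Dt by auto
    have "ip b (a + l) = ip b a"
      using ip_degree[OF aR \<open>b \<in> Rd\<close> l, of 0] additive_subgroupD(1)[OF Lt_subgroup] by simp
    then have "2 * ip b (a + l) = ip a a" using aD by (simp add: b_def ip_cscale mult.commute)
    then have "cartan ip b (a + l) = 1"
      using ip_degree[OF aR aR l l] Rd_nonisotropic[OF aR] a unfolding cartan_def by simp
    then have "b - (a + l) \<in> R"
      using reflection_root[OF a(2), of b] indivisible_Rx[OF b] RxD(1) by simp
    then have "- (b - (a + l)) \<in> R" by (rule R_neg)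
    moreover have "- (b - (a + l)) = b + l"
      by (rule ext) (simp add: b_def)
    ultimately show ?thesis using b l by (intro zspan_base) (auto simp: S_def)
  qed
  have "T0 \<subseteq> zspan ?U"
  proof
    fix d assume d: "d \<in> T0"
    obtain a l where a: "a \<in> Rd - {0}" "l \<in> Lt" "a + l \<in> Rx" "a + (l + d) \<in> Rx"
      using T0_degrees[OF d] by blast
    have "l + d \<in> Lt" using a T0_Lt[OF d] additive_subgroupD[OF Lt_subgroup] by blast
    then have "l + d \<in> zspan ?U" "l \<in> zspan ?U" using gen a by blast+
    then have "(l + d) - l \<in> zspan ?U" by (rule zspan_diff)
    then show "d \<in> zspan ?U" by simp
  qed
  then have "Lt \<subseteq> zspan ?U" unfolding Lambda_t_def zspan_subset_iff .
  moreover have "zspan ?U \<subseteq> Lt" by (intro zspan_least Lt_subgroup) (auto simp: S_def)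
  ultimately have "zspan U = Lt" using U by blast
  then show ?thesis using finitely_generated_imp_free_abelian[OF U(1)] by blast
qed

section \<open>The quotient Lie algebra and its grading\<close>

lemma p_comb: "x \<in> C \<Longrightarrow> y \<in> C \<Longrightarrow> p (sg c x + y) = sl c (p x) + p y"
  and p_br: "x \<in> C \<Longrightarrow> y \<in> C \<Longrightarrow> p (br x y) = brL (p x) (p y)"
  and p_surj: "p ` C = UNIV"
  and p_kernel: "{x \<in> C. p x = 0} = Z"
  using quot unfolding is_quotient_map_def by blast+

lemma core_closed:
  "0 \<in> C" "x \<in> C \<Longrightarrow> y \<in> C \<Longrightarrow> x + y \<in> C" "x \<in> C \<Longrightarrow> sg c x \<in> C"
  using core_subspace V.subspace_0 V.subspace_add V.subspace_scale by blast+

lemma p_zero: "p 0 = 0"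
proof -
  have "0 \<in> Z" using core_closed(1) by (simp add: center_of_def)
  then show ?thesis using p_kernel by blast
qed

lemma sl_one: "sl 1 u = u"
proof -
  obtain x where "x \<in> C" "u = p x" using p_surj by blast
  then show ?thesis using p_comb[of x 0 1] core_closed p_zero by simp
qed

lemma p_add: "x \<in> C \<Longrightarrow> y \<in> C \<Longrightarrow> p (x + y) = p x + p y"
  using p_comb[of x y 1] by (simp add: sl_one)

lemma p_scale: "x \<in> C \<Longrightarrow> p (sg c x) = sl c (p x)"
  using p_comb[of x 0 c] core_closed p_zero by simp

lemma p_sum: "(\<And>i. i \<in> F \<Longrightarrow> v i \<in> C) \<Longrightarrow> p (\<Sum>i\<in>F. v i) = (\<Sum>i\<in>F. p (v i))"
proof (induct F rule: infinite_finite_induct)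
  case (insert i F)
  have "(\<Sum>i\<in>F. v i) \<in> C" using insert.prems by (intro V.subspace_sum core_subspace) auto
  then show ?case using insert by (simp add: p_add)
qed (simp_all add: p_zero)

lemma p_obtain: obtains x where "x \<in> C" "u = p x"
  using p_surj by blast

text \<open>\<open>is_quotient_map\<close> presupposes no structure on its target; surjectivity of
  \<open>p\<close> carries each axiom over from the core.\<close>

sublocale W: vector_space sl
proof
  fix a b :: complex and u v :: 'l
  obtain x y where x: "x \<in> C" "u = p x" and y: "y \<in> C" "v = p y" using p_obtain by metis
  show "sl a (u + v) = sl a u + sl a v"
    using x y core_closed by (simp flip: p_add p_scale add: V.scale_right_distrib)
  show "sl (a + b) u = sl a u + sl b u"
    using x core_closed by (simp flip: p_add p_scale add: V.scale_left_distrib)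
  show "sl a (sl b u) = sl (a * b) u"
    using x core_closed by (simp flip: p_scale)
  show "sl 1 u = u" by (rule sl_one)
qed

lemma lie_quotient: "lie_algebra sl brL"
  unfolding lie_algebra_def
proof (intro conjI allI)
  show "vector_space sl" by (rule W.vector_space_axioms)
  fix c u v w
  obtain x y z where x: "x \<in> C" "u = p x" and y: "y \<in> C" "v = p y" and z: "z \<in> C" "w = p z"
    using p_obtain by metis
  show "brL (sl c u + v) w = sl c (brL u w) + brL v w"
    using x y z core_closed core_br by (simp flip: p_br p_comb add: br_comb)
  show "brL u u = 0" using x by (simp flip: p_br add: p_zero)
  have "p (br x (br y z) + br y (br z x) + br z (br x y)) = 0" by (simp only: jacobi p_zero)
  then show "brL u (brL v w) + brL v (brL w u) + brL w (brL u v) = 0"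
    using x y z core_closed core_br by (simp add: p_br p_add)
qed

text \<open>The pair enters only through the functional \<open>a + l\<close>, so additivity of
  degrees is that of root spaces, and \<open>degree_unique\<close> recovers the pair.\<close>

definition L where "L a l = p ` (C \<inter> G (a + l))"

lemma L_I: "x \<in> C \<Longrightarrow> x \<in> G (a + l) \<Longrightarrow> p x \<in> L a l"
  unfolding L_def by blast

lemma L_subspace: "W.subspace (L a l)"
proof -
  have CG: "V.subspace (C \<inter> G (a + l))"
    using core_subspace root_space_subspace by (rule V.subspace_inter)
  show ?thesis
    unfolding W.subspace_def
  proof (intro conjI ballI allI)
    show "0 \<in> L a l" using V.subspace_0[OF CG] p_zero unfolding L_def by (metis imageI)
    show "u + v \<in> L a l" if uv: "u \<in> L a l" "v \<in> L a l" for u v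
    proof -
      obtain x y where "x \<in> C \<inter> G (a + l)" "y \<in> C \<inter> G (a + l)" "u = p x" "v = p y"
        using uv unfolding L_def by blast
      then show ?thesis using V.subspace_add[OF CG, of x y] L_I p_add by (metis IntD1 IntD2)
    qed
    show "sl c u \<in> L a l" if u: "u \<in> L a l" for c u
    proof -
      obtain x where "x \<in> C \<inter> G (a + l)" "u = p x" using u unfolding L_def by blast
      then show ?thesis using V.subspace_scale[OF CG, of x c] L_I p_scale by (metis IntD1 IntD2)
    qed
  qed
qed

lemma L_br: "u \<in> L a l \<Longrightarrow> v \<in> L b m \<Longrightarrow> brL u v \<in> L (a + b) (l + m)"
proof -
  assume "u \<in> L a l" "v \<in> L b m"
  then obtain x y where x: "x \<in> C" "x \<in> G (a + l)" "u = p x" and y: "y \<in> C" "y \<in> G (b + m)" "v = p y"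
    unfolding L_def by blast
  have "br x y \<in> G (a + b + (l + m))" using root_space_br[OF x(2) y(2)] by (simp add: add_ac)
  then show ?thesis using L_I core_br x y p_br by metis
qed

text \<open>A nonzero piece lifts to a nonzero core vector, so \<open>a + l\<close> lies in
  \<open>T\<close> and has a decomposition with finite part in \<open>Rd\<close>; by uniqueness that
  part is \<open>a\<close>.\<close>

lemma L_degree:
  assumes "a \<in> zspan Rd" "l \<in> Lt" "L a l \<noteq> {0}"
  shows "a \<in> Rd" "a + l \<in> T"
proof -
  obtain x where x: "x \<in> C" "x \<in> G (a + l)" "x \<noteq> 0"
    using assms(3) W.subspace_0[OF L_subspace] p_zero unfolding L_def by auto
  have "a + l \<in> D" using zspan_Rd_dual[OF assms(1)] Lt_Dt[OF assms(2)] by simp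
  then show T: "a + l \<in> T" using core_homogeneous x by blast
  then obtain b m where "b \<in> Rd" "m \<in> Lt" "a + l = b + m" using T_degree by blast
  then show "a \<in> Rd" using degree_unique[of a b l m] assms zspan_base by metis
qed

lemma L_Rx_nonzero: assumes "a + l \<in> Rx" shows "L a l \<noteq> {0}"
proof -
  obtain x where x: "x \<in> G (a + l)" "x \<noteq> 0" using RxD[OF assms] root_obtain by blast
  have "x \<in> C" using core_base[OF assms x(1)] .
  moreover have "p x \<noteq> 0" using center_root_space[OF assms x(1)] x(2) \<open>x \<in> C\<close> p_kernel by blast
  ultimately show ?thesis using L_I x(1) by blast
qed

lemma L_Rx:
  assumes "a \<in> Rd" "a \<noteq> 0" "l \<in> Lt" "L a l \<noteq> {0}"
  shows "a + l \<in> Rx"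
  using L_degree[OF zspan_base[OF assms(1)] assms(3,4)] T_root shifted_root_Rx assms by blast

lemma L_spanning:
  "\<exists>F v. finite F \<and> F \<subseteq> zspan Rd \<times> Lt \<and> (\<forall>(a, l)\<in>F. v (a, l) \<in> L a l) \<and> u = (\<Sum>q\<in>F. v q)"
proof -
  obtain x where x: "x \<in> C" "u = p x" using p_obtain .
  obtain E w where E: "finite E" "E \<subseteq> T" "\<And>b. b \<in> E \<Longrightarrow> w b \<in> core_part b" "x = (\<Sum>b\<in>E. w b)"
    using core_decomposition[OF x(1)] by blast
  have w: "w b \<in> C" "w b \<in> G b" if "b \<in> E" for b
    using E(3)[OF that] core_part_core core_part_root_space by blast+
  have "\<forall>b\<in>E. \<exists>q. fst q \<in> Rd \<and> snd q \<in> Lt \<and> b = fst q + snd q"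
    using T_degree E(2) by (metis fst_conv snd_conv subsetD)
  from bchoice[OF this]
  obtain d where d: "b \<in> E \<Longrightarrow> fst (d b) \<in> Rd \<and> snd (d b) \<in> Lt \<and> b = fst (d b) + snd (d b)" for b
    by blast
  define f g where "f = fst \<circ> d" and "g = snd \<circ> d"
  have fg: "f b \<in> Rd" "g b \<in> Lt" "f b + g b = b" if "b \<in> E" for b
    using d[OF that] unfolding f_def g_def o_apply by metis+
  define F where "F = (\<lambda>b. (f b, g b)) ` E"
  have inj: "inj_on (\<lambda>b. (f b, g b)) E"
  proof (rule inj_onI)
    fix b c assume bc: "b \<in> E" "c \<in> E" "(f b, g b) = (f c, g c)"
    have "b = f b + g b" using fg(3)[OF bc(1)] by (rule sym)
    also have "\<dots> = f c + g c" using bc(3) by (simp only: prod.inject)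
    also have "\<dots> = c" by (rule fg(3)[OF bc(2)])
    finally show "b = c" .
  qed
  define v where "v q = p (w (fst q + snd q))" for q
  have v: "v (f b, g b) = p (w b)" if "b \<in> E" for b using fg(3)[OF that] by (simp add: v_def)
  have "u = (\<Sum>b\<in>E. p (w b))" using x E(4) p_sum[of E w] w by simp
  also have "\<dots> = (\<Sum>q\<in>F. v q)" unfolding F_def sum.reindex[OF inj] using v by simp
  finally have "u = (\<Sum>q\<in>F. v q)" .
  moreover have "v (f b, g b) \<in> L (f b) (g b)" if "b \<in> E" for b
    using L_I[OF w(1)[OF that], of "f b" "g b"] w(2)[OF that] fg(3)[OF that] v[OF that] by simp
  ultimately show ?thesis
    using E(1) fg(1,2) by (intro exI[of _ F] exI[of _ v]) (auto simp: F_def intro: zspan_base)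
qed

text \<open>A vanishing sum lifts to a central element rather than to zero; homogeneity of the
  center then makes every lift central.\<close>

lemma L_independent:
  assumes F: "finite F" "F \<subseteq> zspan Rd \<times> Lt" and v: "\<forall>(a, l)\<in>F. v (a, l) \<in> L a l"
    and s: "(\<Sum>q\<in>F. v q) = 0" and q: "q \<in> F"
  shows "v q = 0"
proof -
  have "\<forall>q\<in>F. \<exists>x. x \<in> C \<inter> G (fst q + snd q) \<and> v q = p x" using v unfolding L_def by fastforce
  then obtain x where x: "\<And>q. q \<in> F \<Longrightarrow> x q \<in> C \<inter> G (fst q + snd q)" "\<And>q. q \<in> F \<Longrightarrow> v q = p (x q)"
    by metis
  have "(\<Sum>q\<in>F. x q) \<in> C" using x(1) by (intro V.subspace_sum core_subspace) blast
  moreover have "p (\<Sum>q\<in>F. x q) = 0" using p_sum[of F x] x s by simp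
  ultimately have "(\<Sum>q\<in>F. x q) \<in> Z" using p_kernel by blast
  moreover have "inj_on (\<lambda>q. fst q + snd q) F"
  proof (rule inj_onI)
    fix q r assume qr: "q \<in> F" "r \<in> F" "fst q + snd q = fst r + snd r"
    then have "fst q \<in> zspan Rd" "fst r \<in> zspan Rd" "snd q \<in> Lt" "snd r \<in> Lt" using F(2) by auto
    from degree_unique[OF this qr(3)] show "q = r" by (rule prod_eqI)
  qed
  moreover have "fst q + snd q \<in> D" if "q \<in> F" for q
  proof -
    have "fst q \<in> zspan Rd" "snd q \<in> Lt" using F(2) that by auto
    then show ?thesis using zspan_Rd_dual Lt_Dt by simp
  qed
  ultimately have "x q \<in> Z" using center_homogeneous[OF F(1), of "\<lambda>q. fst q + snd q" x] x(1) q by blast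
  then show ?thesis using x(2)[OF q] p_kernel by auto
qed

lemma L_dim_le_one:
  assumes "a \<in> Rd" "a \<noteq> 0" "l \<in> Lt"
  shows "\<exists>v. L a l \<subseteq> W.span {v}"
proof (cases "L a l = {0}")
  case True
  then show ?thesis using W.span_zero by auto
next
  case False
  have al: "a + l \<in> Rx" using L_Rx assms False by blast
  obtain e where e: "e \<in> G (a + l)" "e \<noteq> 0" using RxD[OF al] root_obtain by blast
  have "u \<in> W.span {p e}" if "u \<in> L a l" for u
  proof -
    obtain x where x: "x \<in> G (a + l)" "u = p x" using \<open>u \<in> L a l\<close> unfolding L_def by blast
    then obtain c where "x = sg c e"
      using Rx_root_space_dim_one[OF al e] V.span_breakdown_eq[of x e "{}"] by auto
    then show ?thesis using x(2) p_scale core_base[OF al e(1)] W.span_scale W.span_base by (metis singletonI)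
  qed
  then show ?thesis by blast
qed

lemma L_sl2:
  assumes a: "a \<in> Rd" "a \<noteq> 0" and l: "l \<in> Lt" and nz: "L a l \<noteq> {0}"
  shows "\<exists>e\<in>L a l. \<exists>g\<in>L (- a) (- l). brL e g \<in> L 0 0 \<and>
    (\<forall>b\<in>Rd. \<forall>m\<in>Lt. \<forall>x\<in>L b m. brL (brL e g) x = sl (cartan ip b a) x)"
proof -
  have al: "a + l \<in> Rx" using L_Rx assms by blast
  obtain e where e: "e \<in> G (a + l)" "e \<noteq> 0" using RxD[OF al] root_obtain by blast
  obtain f where f: "f \<in> G (- (a + l))"
    "\<And>b v. b \<in> Dt \<Longrightarrow> v \<in> G b \<Longrightarrow> br (br e f) v = sg (cartan ip b (a + l)) v"
    using sl2_triple[OF al e] by metis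
  have C: "e \<in> C" "f \<in> C" using core_base al Rx_neg e(1) f(1) by blast+
  have "- (a + l) = - a + - l" by simp
  then have L: "p e \<in> L a l" "p f \<in> L (- a) (- l)" using L_I C e(1) f(1) by metis+
  moreover have "brL (p e) (p f) \<in> L 0 0" using L_br[OF L] by simp
  moreover have "brL (brL (p e) (p f)) x = sl (cartan ip b a) x"
    if b: "b \<in> Rd" and m: "m \<in> Lt" and x: "x \<in> L b m" for b m x
  proof -
    obtain y where y: "y \<in> C" "y \<in> G (b + m)" "x = p y" using x unfolding L_def by blast
    have "cartan ip (b + m) (a + l) = cartan ip b a"
      using ip_degree a l b m by (simp add: cartan_def)
    then have "br (br e f) y = sg (cartan ip b a) y"
      using f(2)[OF _ y(2)] Rd_Dt[OF b] Lt_Dt[OF m] by simp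
    then show ?thesis using y C core_br p_br p_scale by metis
  qed
  ultimately show ?thesis by blast
qed

lemma p_span:
  assumes "S \<subseteq> C" "x \<in> V.span S" shows "p x \<in> W.span (p ` S)"
proof -
  have "x \<in> C \<and> p x \<in> W.span (p ` S)"
    using assms(2)
  proof (induct rule: V.span_induct_alt)
    case (step c x y)
    then have x: "x \<in> C" "p x \<in> W.span (p ` S)" and y: "y \<in> C" "p y \<in> W.span (p ` S)"
      using assms(1) by (auto intro: W.span_base)
    then have "p (sg c x + y) \<in> W.span (p ` S)"
      by (simp only: p_comb W.span_add W.span_scale)
    then show ?case using core_closed x(1) y(1) by blast
  qed (simp add: core_closed p_zero W.span_zero)
  then show ?thesis ..
qed

text \<open>\<open>l\<close> has square length 0, so core vectors of weight \<open>l\<close> are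
  sums of brackets of nonisotropic degrees \<open>b + c = l\<close>. Writing
  \<open>b = a + m\<close> with \<open>a \<noteq> 0\<close> gives
  \<open>c = - a + (l - m)\<close>.\<close>

lemma L_zero_degree:
  assumes l: "l \<in> Lt"
  shows "L 0 l = W.span {brL x y | x y a m. a \<in> Rd - {0} \<and> m \<in> Lt \<and> x \<in> L a m \<and> y \<in> L (- a) (l - m)}"
    (is "_ = W.span ?S")
proof
  show "L 0 l \<subseteq> W.span ?S"
  proof
    fix u assume "u \<in> L 0 l"
    then obtain x where x: "x \<in> C" "x \<in> G l" "u = p x" unfolding L_def by auto
    show "u \<in> W.span ?S"
    proof (cases "x = 0")
      case True
      then show ?thesis using x(3) p_zero W.span_zero by simp
    next
      case False
      have "l \<notin> Rx" using RxD(3) Lt_orthogonal_Lt[OF l l] by blast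
      then have xs: "x \<in> V.span {br x y | x y b c. b \<in> Rx \<and> c \<in> Rx \<and> b + c = l \<and> x \<in> G b \<and> y \<in> G c}"
        (is "x \<in> V.span ?U")
        using core_homogeneous(2)[OF x(1,2) _ False] Lt_Dt[OF l] by (simp add: core_part_def)
      have "?U \<subseteq> C" using core_base core_br by blast
      have "p z \<in> ?S" if "z \<in> ?U" for z
      proof -
        obtain x y b c where z: "z = br x y" "b \<in> Rx" "c \<in> Rx" "b + c = l" "x \<in> G b" "y \<in> G c"
          using \<open>z \<in> ?U\<close> by blast
        obtain a m where a: "a \<in> Rd - {0}" "m \<in> Lt" "b = a + m" using Rx_degree[OF z(2)] by blast
        have "c = - a + (l - m)" using z(4) a(3) by (auto simp: algebra_simps)
        then have "p y \<in> L (- a) (l - m)" "p x \<in> L a m"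
          using L_I core_base z a(3) by blast+
        moreover have "p z = brL (p x) (p y)" using z p_br core_base by blast
        ultimately show ?thesis using a by blast
      qed
      then have "p ` ?U \<subseteq> ?S" by blast
      then show ?thesis using p_span[OF \<open>?U \<subseteq> C\<close> xs] W.span_mono x(3) by blast
    qed
  qed
  have "?S \<subseteq> L 0 l"
  proof
    fix u assume "u \<in> ?S"
    then obtain x y a m where "u = brL x y" "x \<in> L a m" "y \<in> L (- a) (l - m)" by blast
    then show "u \<in> L 0 l" using L_br[of x a m y "- a" "l - m"] by simp
  qed
  then show "W.span ?S \<subseteq> L 0 l" by (rule W.span_minimal[OF _ L_subspace])
qed

lemma L_support: "Lt = zspan {l \<in> Lt. \<exists>a\<in>Rd. L a l \<noteq> {0}}" (is "_ = zspan ?S")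
proof
  have "d \<in> zspan ?S" if d: "d \<in> T0" for d
  proof -
    obtain a l where a: "a \<in> Rd - {0}" "l \<in> Lt" "a + l \<in> Rx" "a + (l + d) \<in> Rx"
      using T0_degrees[OF d] by blast
    have "l + d \<in> Lt" using a T0_Lt[OF d] additive_subgroupD[OF Lt_subgroup] by blast
    then have "l + d \<in> ?S" "l \<in> ?S"
      using L_Rx_nonzero[OF a(3)] L_Rx_nonzero[OF a(4)] a(1,2) by auto
    from zspan_diff[OF this[THEN zspan_base]] have "(l + d) - l \<in> zspan ?S" .
    then show ?thesis by simp
  qed
  then show "Lt \<subseteq> zspan ?S" by (subst Lambda_t_def) (auto simp: zspan_subset_iff)
  show "zspan ?S \<subseteq> Lt" by (intro zspan_least Lt_subgroup) blast
qed

lemma lie_torus_core_quotient: "lie_torus sl brL ip Rd Lt"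
  unfolding lie_torus_def functional_ops
proof (intro conjI exI[of _ L])
  show "\<forall>a\<in>zspan Rd - Rd. \<forall>l\<in>Lt. L a l = {0}" using L_degree by blast
  show "\<forall>a\<in>indivisible Rd. L a 0 \<noteq> {0}" using L_Rx_nonzero indivisible_Rx by simp
  show "\<forall>a\<in>zspan Rd. \<forall>l\<in>Lt. W.subspace (L a l)" using L_subspace by blast
  show "\<forall>a\<in>Rd - {0}. \<forall>l\<in>Lt. \<exists>v. L a l \<subseteq> W.span {v}" using L_dim_le_one by blast
  show "\<forall>x. \<exists>F v. finite F \<and> F \<subseteq> zspan Rd \<times> Lt \<and> (\<forall>(a, l)\<in>F. v (a, l) \<in> L a l) \<and> x = (\<Sum>p\<in>F. v p)"
    using L_spanning by blast
  show "\<forall>F v. finite F \<and> F \<subseteq> zspan Rd \<times> Lt \<and> (\<forall>(a, l)\<in>F. v (a, l) \<in> L a l) \<and> (\<Sum>p\<in>F. v p) = 0 \<longrightarrow>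
      (\<forall>p\<in>F. v p = 0)"
    using L_independent by blast
  show "\<forall>a\<in>zspan Rd. \<forall>b\<in>zspan Rd. \<forall>l\<in>Lt. \<forall>m\<in>Lt. \<forall>x\<in>L a l. \<forall>y\<in>L b m. brL x y \<in> L (a + b) (l + m)"
    using L_br by blast
  show "\<forall>a\<in>Rd - {0}. \<forall>l\<in>Lt. L a l \<noteq> {0} \<longrightarrow> (\<exists>e\<in>L a l. \<exists>g\<in>L (- a) (- l). brL e g \<in> L 0 0 \<and>
      (\<forall>b\<in>Rd. \<forall>m\<in>Lt. \<forall>x\<in>L b m. brL (brL e g) x = sl (cartan ip b a) x))"
    using L_sl2 by blast
  show "\<forall>l\<in>Lt. L 0 l = W.span {brL x y | x y a m. a \<in> Rd - {0} \<and> m \<in> Lt \<and> x \<in> L a m \<and> y \<in> L (- a) (l - m)}"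
    using L_zero_degree by blast
qed (rule lie_quotient Rd_rs Lt_free L_support)+

end

theorem theorem3p1:
  fixes sg :: "complex \<Rightarrow> 'g::ab_group_add \<Rightarrow> 'g"
    and br :: "'g \<Rightarrow> 'g \<Rightarrow> 'g"
    and B :: "'g \<Rightarrow> 'g \<Rightarrow> complex"
    and H :: "'g set"
    and Rd :: "('g \<Rightarrow> complex) set"
    and sl :: "complex \<Rightarrow> 'l::ab_group_add \<Rightarrow> 'l"
    and brL :: "'l \<Rightarrow> 'l \<Rightarrow> 'l"
    and p :: "'g \<Rightarrow> 'l"
  assumes GRLA: "grla sg br B H"
    and indec: "indecomposable br sg B H"
    and Rd_dual: "Rd \<subseteq> dual sg H"
    and Rd_rs: "irreducible_finite_root_system (fform B H) Rd"
    and Rt_sub: "Rt br sg B H \<subseteq> {fplus a l | a l. a \<in> Rd \<and> l \<in> Lambda_t br sg B H}"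
    and Rd_ind: "indivisible Rd \<subseteq> nonisotropic_roots br sg B H \<union> {fzero}"
    and span_R: "zspan (roots br sg H) = {fplus a l | a l. a \<in> zspan Rd \<and> l \<in> Lambda br sg B H}"
    and direct: "zspan Rd \<inter> Lambda br sg B H = {fzero}"
    and quot: "is_quotient_map sg br sl brL p (core sg br B H) (center_of br (core sg br B H))"
  shows "lie_torus sl brL (fform B H) Rd (Lambda_t br sg B H)"
proof -
  interpret core_quotient sg br B H Rd sl brL p
    by unfold_locales (fact GRLA Rd_dual Rd_rs Rt_sub Rd_ind span_R direct quot)+
  show ?thesis by (rule lie_torus_core_quotient)
qed

end
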